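(* Let $K$ be an algebraically closed field with uncountably many elements and $n\ge1$. Let $y\in\mathbb{A}^n_{K,\infty}$ be a (not necessarily closed) point and let $I\subset K[x_{ij}:i\in\mathbb{N},j\in\{1,\dots,n\}]$ be the vanishing ideal of the orbit closure of $y$. Then there are an affine integral scheme $X$ of finite type over $K$, closed subschemes $\Sigma_0,\dots,\Sigma_r\subset X\times\mathbb{A}^n_K$ (for some integer $r\ge0$) and natural numbers $m_1,\dots,m_r$ such that $I$ is the vanishing ideal of the set of all sequences $(p_i)_{i\in\mathbb{N}}\subset\mathbb{A}^n_K(K)$ for which there exists $x\in X(K)$ with: (1) for all $i\in\mathbb{N}$ we have $p_i\in\Sigma(0,x)$, and (2) for all $j\in\{1,\dots,r\}$ there are at most $m_j$ indices $i\in\mathbb{N}$ such that $p_i\notin\Sigma(j,x)$. Here $\Sigma(j,x)\subset\mathbb{A}^n_K(K)$ denotes the fiber of $x\in X(K)$ under $\operatorname{pr}_1:\Sigma_j\to X$.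
   Context: $S=K[x_{ij}:i\in\mathbb{N},j\in\{1,\dots,n\}]$, $\mathbb{A}^n_{K,\infty}=\operatorname{Spec}(S)$, and $G=\operatorname{Sym}(\infty)=\bigcup_k\operatorname{Sym}(k)$ acts on $S$ via $\sigma(x_{ij})=x_{\sigma(i)j}$ and hence on $\mathbb{A}^n_{K,\infty}$. The orbit closure of $y$ is the Zariski closure of $\{\sigma(y):\sigma\in G\}$ in $\mathbb{A}^n_{K,\infty}$. Sequences $(p_i)_{i\in\mathbb{N}}$ in $\mathbb{A}^n_K(K)=K^n$ are identified with the $K$-rational points of $\mathbb{A}^n_{K,\infty}$; the vanishing ideal of a set of such sequences is the set of all $f\in S$ vanishing at each of them. Fibers over $x\in X(K)$ are viewed as subsets of $\mathbb{A}^n_K(K)$ by taking $K$-points and projecting to $\mathbb{A}^n_K$. *)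

theory Defs
  imports
    "HOL-Library.Poly_Mapping"
    "HOL-Library.Countable_Set"
    "HOL-Analysis.Abstract_Topology"
    "HOL-Analysis.Finite_Cartesian_Product"
    "HOL-Combinatorics.Permutations"
    "HOL-Algebra.Algebraic_Closure_Type"
    "HOL-Algebra.Generated_Rings"
begin

section \<open>Polynomials over a type-class field\<close>

text \<open>
  Elements of \<^typ>\<open>'v \<Rightarrow>\<^sub>0 nat\<close> are the monomials in the variables indexed by \<^typ>\<open>'v\<close>.
\<close>

type_synonym ('v, 'k) mpoly = "('v \<Rightarrow>\<^sub>0 nat) \<Rightarrow>\<^sub>0 'k"

definition mp_const :: "'k::comm_ring_1 \<Rightarrow> ('v, 'k) mpoly" where
  "mp_const c = Poly_Mapping.single 0 c"

definition mp_var :: "'v \<Rightarrow> ('v, 'k::comm_ring_1) mpoly" where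
  "mp_var v = Poly_Mapping.single (Poly_Mapping.single v 1) 1"

text \<open>
  Apply \<open>h\<close> to the coefficients and substitute \<open>\<theta> v\<close> for the variable \<open>v\<close>.
\<close>

definition mp_subst :: "('k::comm_ring_1 \<Rightarrow> 'b::comm_ring_1) \<Rightarrow> ('v \<Rightarrow> 'b) \<Rightarrow> ('v, 'k) mpoly \<Rightarrow> 'b" where
  "mp_subst h \<theta> f =
     (\<Sum>m\<in>Poly_Mapping.keys f.
        h (Poly_Mapping.lookup f m) * (\<Prod>v\<in>Poly_Mapping.keys m. \<theta> v ^ Poly_Mapping.lookup m v))"

lemma mp_subst_var:
  assumes "h 1 = 1"
  shows "mp_subst h \<theta> (mp_var v) = \<theta> v"
  using assms by (simp add: mp_subst_def mp_var_def)

lemma mp_subst_const: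
  assumes "h 0 = 0"
  shows "mp_subst h \<theta> (mp_const c) = h c"
  using assms by (simp add: mp_subst_def mp_const_def)


section \<open>The prime spectrum and the Zariski topology\<close>

definition Spec :: "'a::comm_ring_1 set set" where
  "Spec = {P. primeideal P (ring_of_type_algebra :: 'a ring)}"

definition zero_locus :: "'a::comm_ring_1 set \<Rightarrow> 'a set set" where
  "zero_locus E = {P \<in> Spec. E \<subseteq> P}"

definition zariski :: "'a::comm_ring_1 set topology" where
  "zariski = topology (\<lambda>U. \<exists>E. U = Spec - zero_locus E)"

lemma zero_locus_Un:
  "zero_locus E \<union> zero_locus F = zero_locus {a * b | a b. a \<in> E \<and> b \<in> F}"
proof -
  have "E \<subseteq> P \<or> F \<subseteq> P \<longleftrightarrow> {a * b | a b. a \<in> E \<and> b \<in> F} \<subseteq> P" if "P \<in> Spec" for P :: "'a set"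
  proof -
    interpret primeideal P "ring_of_type_algebra :: 'a ring"
      using that by (simp add: Spec_def)
    have prime: "a \<in> P \<or> b \<in> P" if "a * b \<in> P" for a b
      using I_prime[of a b] that by (simp add: ring_of_type_algebra_def)
    have absorb: "a * b \<in> P" "b * a \<in> P" if "a \<in> P" for a b
      using I_l_closed[of a b] I_r_closed[of a b] that
      by (simp_all add: ring_of_type_algebra_def mult.commute)
    show ?thesis
      using prime absorb by blast
  qed
  then show ?thesis
    unfolding zero_locus_def by blast
qed

lemma istopology_zariski:
  "istopology (\<lambda>U :: 'a::comm_ring_1 set set. \<exists>E. U = Spec - zero_locus E)"
  unfolding istopology_def
proof (intro conjI allI impI)
  fix U V :: "'a set set"
  assume "\<exists>E. U = Spec - zero_locus E" "\<exists>E. V = Spec - zero_locus E"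
  then obtain E F where "U = Spec - zero_locus E" "V = Spec - zero_locus F"
    by blast
  then have "U \<inter> V = Spec - (zero_locus E \<union> zero_locus F)"
    by blast
  then show "\<exists>E. U \<inter> V = Spec - zero_locus E"
    unfolding zero_locus_Un by blast
next
  fix \<U> :: "'a set set set"
  assume "\<forall>U\<in>\<U>. \<exists>E. U = Spec - zero_locus E"
  then obtain e where e: "\<And>U. U \<in> \<U> \<Longrightarrow> U = Spec - zero_locus (e U)"
    by metis
  have "\<Union>\<U> = (\<Union>U\<in>\<U>. Spec - zero_locus (e U))"
    using e by auto
  also have "\<dots> = Spec - zero_locus (\<Union>U\<in>\<U>. e U)"
    unfolding zero_locus_def by blast
  finally show "\<exists>E. \<Union>\<U> = Spec - zero_locus E"
    by blast
qed

lemma openin_zariski: "openin zariski U \<longleftrightarrow> (\<exists>E. U = Spec - zero_locus E)"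
  by (simp add: zariski_def topology_inverse'[OF istopology_zariski])

lemma topspace_zariski: "topspace zariski = (Spec :: 'a::comm_ring_1 set set)"
proof
  show "topspace zariski \<subseteq> (Spec :: 'a set set)"
    using openin_topspace[of "zariski :: 'a set topology"] unfolding openin_zariski by blast
  have "zero_locus UNIV = ({} :: 'a set set)"
    using primeideal.I_notcarr
    by (fastforce simp: zero_locus_def Spec_def ring_of_type_algebra_def)
  then have "openin zariski (Spec :: 'a set set)"
    unfolding openin_zariski by (metis Diff_empty)
  then show "(Spec :: 'a set set) \<subseteq> topspace zariski"
    by (rule openin_subset)
qed

lemma closedin_zariski: "closedin zariski Z \<longleftrightarrow> (\<exists>E. Z = zero_locus E)"
proof -
  have "zero_locus E \<subseteq> Spec" for E :: "'a set"
    by (auto simp: zero_locus_def)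
  then show ?thesis
    unfolding closedin_def openin_zariski topspace_zariski
    by (metis double_diff subset_refl Diff_subset)
qed

text \<open>A function vanishes at the point \<open>P\<close> if its image in the residue field is zero.\<close>

definition vanishing_ideal :: "'a::comm_ring_1 set set \<Rightarrow> 'a set" where
  "vanishing_ideal Z = {f. \<forall>P\<in>Z. f \<in> P}"


section \<open>The action of the infinite symmetric group\<close>

text \<open>
  The variable $x_{ij}$ is indexed by \<open>(i, j)\<close>, where \<open>j\<close> ranges over a finite type with
  \<open>n\<close> elements.
\<close>

definition Sym_infty :: "(nat \<Rightarrow> nat) set" where
  "Sym_infty = (\<Union>k. {\<sigma>. \<sigma> permutes {..<k}})"

definition perm_act ::
    "(nat \<Rightarrow> nat) \<Rightarrow> (nat \<times> 'n, 'k::comm_ring_1) mpoly \<Rightarrow> (nat \<times> 'n, 'k) mpoly" where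
  "perm_act \<sigma> = mp_subst mp_const (\<lambda>(i, j). mp_var (\<sigma> i, j))"

lemma perm_act_var: "perm_act \<sigma> (mp_var (i, j)) = mp_var (\<sigma> i, j)"
  by (simp add: perm_act_def mp_subst_var mp_const_def)

text \<open>
  On points, \<open>\<sigma>\<close> acts by \<open>P \<mapsto> \<sigma>(P)\<close>, the preimage of \<open>P\<close> under \<open>\<sigma>\<inverse>\<close>.
\<close>

definition point_orbit :: "(nat \<times> 'n, 'k::comm_ring_1) mpoly set \<Rightarrow> (nat \<times> 'n, 'k) mpoly set set" where
  "point_orbit y = {perm_act \<sigma> ` y | \<sigma>. \<sigma> \<in> Sym_infty}"

definition orbit_closure ::
    "(nat \<times> 'n, 'k::comm_ring_1) mpoly set \<Rightarrow> (nat \<times> 'n, 'k) mpoly set set" where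
  "orbit_closure y = zariski closure_of point_orbit y"

definition vanishing_ideal_seqs ::
    "(nat \<Rightarrow> 'k::comm_ring_1 ^ 'n) set \<Rightarrow> (nat \<times> 'n, 'k) mpoly set" where
  "vanishing_ideal_seqs T = {f. \<forall>p\<in>T. mp_subst id (\<lambda>(i, j). p i $ j) f = 0}"


section \<open>Affine integral schemes of finite type and subschemes of their products with affine space\<close>

text \<open>
  An affine scheme over \<open>K\<close> is given by its coordinate ring, a \<open>K\<close>-algebra \<open>A\<close>.
\<close>

definition affine_integral_finite_type :: "('k::field, 'a) module \<Rightarrow> bool" where
  "affine_integral_finite_type A \<longleftrightarrow>
     algebra (ring_of_type_algebra :: 'k ring) A \<and> domain A \<and>
     (\<exists>F. finite F \<and> F \<subseteq> carrier A \<and>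
          carrier A = generate_ring A (range (\<lambda>c. c \<odot>\<^bsub>A\<^esub> \<one>\<^bsub>A\<^esub>) \<union> F))"

text \<open>The \<open>K\<close>-algebra homomorphisms from \<open>A\<close> to \<open>K\<close>.\<close>

definition K_points :: "('k::field, 'a) module \<Rightarrow> ('a \<Rightarrow> 'k) set" where
  "K_points A = {x \<in> ring_hom A ring_of_type_algebra. \<forall>c. x (c \<odot>\<^bsub>A\<^esub> \<one>\<^bsub>A\<^esub>) = c}"

text \<open>
  The polynomial ring over a ring \<open>A\<close> given by a carrier, in the variables indexed by
  \<^typ>\<open>'v\<close>. A polynomial is the function that maps monomials to coefficients.
\<close>

definition mpoly_ring :: "('a, 'b) ring_scheme \<Rightarrow> (('v \<Rightarrow>\<^sub>0 nat) \<Rightarrow> 'a) ring" where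
  "mpoly_ring A =
     \<lparr>carrier = {f. range f \<subseteq> carrier A \<and> finite {m. f m \<noteq> \<zero>\<^bsub>A\<^esub>}},
      monoid.mult = (\<lambda>f g m. finsum A (\<lambda>(a, b). f a \<otimes>\<^bsub>A\<^esub> g b) {(a, b). a + b = m}),
      one = (\<lambda>m. if m = 0 then \<one>\<^bsub>A\<^esub> else \<zero>\<^bsub>A\<^esub>),
      zero = (\<lambda>m. \<zero>\<^bsub>A\<^esub>),
      add = (\<lambda>f g m. f m \<oplus>\<^bsub>A\<^esub> g m)\<rparr>"

text \<open>The sum defining the product is finite, so \<^const>\<open>finsum\<close> has its intended value.\<close>

lemma finite_monomial_splittings: "finite {(a, b). a + b = (m :: 'v \<Rightarrow>\<^sub>0 nat)}"
proof -
  let ?l = "Poly_Mapping.lookup :: ('v \<Rightarrow>\<^sub>0 nat) \<Rightarrow> _"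
  let ?B = "{g. \<forall>v. (v \<in> Poly_Mapping.keys m \<longrightarrow> g v \<in> {..Max (range (?l m))}) \<and>
                    (v \<notin> Poly_Mapping.keys m \<longrightarrow> g v = (0::nat))}"
  have fin: "finite (range (?l m))"
    by (rule finite_subset[of _ "insert 0 (?l m ` Poly_Mapping.keys m)"])
       (auto simp: in_keys_iff)
  have fin_B: "finite ?B"
    by (rule finite_set_of_finite_funs) simp_all
  have mem: "?l a \<in> ?B" if "a + b = m" for a b
  proof -
    have le: "?l a v \<le> ?l m v" for v
      using that by (auto simp: lookup_add)
    have "?l a v \<le> Max (range (?l m))" for v
      using le[of v] Max_ge[OF fin, of "?l m v"] by auto
    moreover have "?l a v = 0" if "v \<notin> Poly_Mapping.keys m" for v
      using le[of v] that by (simp add: in_keys_iff)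
    ultimately show ?thesis
      by auto
  qed
  have "?l ` {a. \<exists>b. a + b = m} \<subseteq> ?B"
    by (rule image_subsetI, erule CollectE, erule exE, rule mem)
  then have "finite (?l ` {a. \<exists>b. a + b = m})"
    using fin_B by (rule finite_subset)
  then have "finite {a. \<exists>b. a + b = m}"
    by (rule finite_imageD) (rule inj_onI, simp only: Poly_Mapping.lookup_inject)
  then have "finite ((\<lambda>a. (a, m - a)) ` {a. \<exists>b. a + b = m})"
    by (rule finite_imageI)
  moreover have "{(a, b). a + b = m} \<subseteq> (\<lambda>a. (a, m - a)) ` {a. \<exists>b. a + b = m}"
    by (clarsimp simp: image_iff)
  ultimately show ?thesis
    by (rule rev_finite_subset)
qed

text \<open>
  Since $X \times_K A^n_K$ is the spectrum of $A[x_1,\dots,x_n]$, its closed subschemes are given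
  by the ideals of this ring.
\<close>

definition closed_subscheme_prod ::
    "('k::field, 'a) module \<Rightarrow> (('n::finite \<Rightarrow>\<^sub>0 nat) \<Rightarrow> 'a) set \<Rightarrow> bool" where
  "closed_subscheme_prod A J \<longleftrightarrow> ideal J (mpoly_ring A)"

definition eval_at ::
    "('k::field, 'a) module \<Rightarrow> ('a \<Rightarrow> 'k) \<Rightarrow> 'k ^ 'n::finite \<Rightarrow> (('n \<Rightarrow>\<^sub>0 nat) \<Rightarrow> 'a) \<Rightarrow> 'k" where
  "eval_at A x p f =
     (\<Sum>m | f m \<noteq> \<zero>\<^bsub>A\<^esub>. x (f m) * (\<Prod>j\<in>UNIV. (p $ j) ^ Poly_Mapping.lookup m j))"

definition fiber ::
    "('k::field, 'a) module \<Rightarrow> (('n::finite \<Rightarrow>\<^sub>0 nat) \<Rightarrow> 'a) set \<Rightarrow> ('a \<Rightarrow> 'k) \<Rightarrow> ('k ^ 'n) set" where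
  "fiber A J x = {p. \<forall>f\<in>J. eval_at A x p f = 0}"

text \<open>
  Every finitely generated \<open>K\<close>-algebra is isomorphic to a quotient of $K[z_0,\dots,z_{d-1}]$,
  whose elements are sets of polynomials. So quantifying over \<open>K\<close>-algebras with this element
  type amounts to quantifying over all \<open>K\<close>-algebras of finite type, up to isomorphism.
\<close>

type_synonym 'k coord_ring = "('k, (nat, 'k) mpoly set) module"

end

theory Submission
  imports Defs
begin

text \<open>
  Think of \<open>y\<close> as a sequence of points \<open>y\<^sub>i = (x\<^sub>i\<^sub>j)\<^sub>j\<close> of affine space over the fraction field of
  \<open>S/y\<close>. Let \<open>Z\<close> be the smallest closed set containing all but finitely many of them. A polynomial
  that vanishes on all injective rearrangements of the sequence vanishes whenever the entries
  lie in \<open>Z\<close>, apart from at most as many copies of each of the finitely many exceptional points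
  as occur in the sequence. So over the fraction field the theorem holds with \<open>\<Sigma>\<^sub>0\<close> the
  union of \<open>Z\<close> and the exceptional points, and \<open>\<Sigma>\<^sub>j\<close> the same union without the \<open>j\<close>-th one.

  The equations of \<open>Z\<close> are spread out over a finitely generated algebra by means of a Groebner
  basis in which the leading coefficients have been inverted. Standard monomials then stay
  a basis in every fibre, which makes all fibre powers of \<open>Z\<close> flat, so that no extra
  components appear over special points; inverting the differences of distinct exceptional
  points keeps them distinct. Fractions are avoided by working modulo \<open>y\<close> in \<open>S\<close>. Conversely, a
  polynomial not vanishing on the orbit of \<open>y\<close> is nonzero at some \<open>K\<close>-sequence on which \<open>y\<close>
  vanishes, by the Nullstellensatz in countably many variables over an uncountable field.
\<close>

section \<open>Substitution in polynomials\<close>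

definition rhom :: "('a::comm_ring_1 \<Rightarrow> 'b::comm_ring_1) \<Rightarrow> bool" where
  "rhom h \<longleftrightarrow> h 1 = 1 \<and> (\<forall>a b. h (a + b) = h a + h b) \<and> (\<forall>a b. h (a * b) = h a * h b)"

lemma rhomI:
  assumes "h 1 = 1" "\<And>a b. h (a + b) = h a + h b" "\<And>a b. h (a * b) = h a * h b"
  shows "rhom h"
  using assms by (simp add: rhom_def)

lemma rhom_simps:
  assumes "rhom h"
  shows rhom_one: "h 1 = 1" and rhom_add: "h (a + b) = h a + h b"
    and rhom_mult: "h (a * b) = h a * h b" and rhom_zero: "h 0 = 0"
    and rhom_minus: "h (- a) = - h a" and rhom_diff: "h (a - b) = h a - h b"
    and rhom_power: "h (a ^ n) = h a ^ n"
proof -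
  show *: "h 1 = 1" "h (a * b) = h a * h b" and add: "h (a + b) = h a + h b" for a b
    using assms by (auto simp: rhom_def)
  show z: "h 0 = 0"
    using add[of 0 0] by simp
  show m: "h (- a) = - h a" for a
    using add[of a "- a"] z by (simp add: eq_neg_iff_add_eq_0 add.commute)
  show "h (a - b) = h a - h b"
    using add[of a "- b"] m by simp
  show "h (a ^ n) = h a ^ n"
    by (induction n) (simp_all add: *)
qed

lemma rhom_sum: "rhom h \<Longrightarrow> h (sum f Y) = (\<Sum>x\<in>Y. h (f x))"
  by (induction Y rule: infinite_finite_induct) (simp_all add: rhom_simps)

lemma rhom_prod: "rhom h \<Longrightarrow> h (prod f Y) = (\<Prod>x\<in>Y. h (f x))"
  by (induction Y rule: infinite_finite_induct) (simp_all add: rhom_simps)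

lemma rhom_id: "rhom id"
  by (simp add: rhom_def)

lemma rhom_comp: "rhom g \<Longrightarrow> rhom h \<Longrightarrow> rhom (\<lambda>a. g (h a))"
  by (simp add: rhom_def)

definition mon_val :: "('v \<Rightarrow> 'b::comm_ring_1) \<Rightarrow> ('v \<Rightarrow>\<^sub>0 nat) \<Rightarrow> 'b" where
  "mon_val \<theta> m = (\<Prod>v\<in>Poly_Mapping.keys m. \<theta> v ^ Poly_Mapping.lookup m v)"

lemma mon_val_superset:
  assumes "finite Y" "Poly_Mapping.keys m \<subseteq> Y"
  shows "mon_val \<theta> m = (\<Prod>v\<in>Y. \<theta> v ^ Poly_Mapping.lookup m v)"
  unfolding mon_val_def using assms
  by (intro prod.mono_neutral_left) (auto simp: in_keys_iff)

lemma mon_val_zero [simp]: "mon_val \<theta> 0 = 1"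
  by (simp add: mon_val_def)

lemma mon_val_add: "mon_val \<theta> (m + m') = mon_val \<theta> m * mon_val \<theta> m'"
proof -
  let ?Y = "Poly_Mapping.keys m \<union> Poly_Mapping.keys m'"
  have "Poly_Mapping.keys (m + m') \<subseteq> ?Y"
    by (rule Poly_Mapping.keys_add)
  then show ?thesis
    by (simp add: mon_val_superset[of ?Y] lookup_add power_add prod.distrib)
qed

lemma mon_val_single [simp]: "mon_val \<theta> (Poly_Mapping.single v k) = \<theta> v ^ k"
  by (cases "k = 0") (simp_all add: mon_val_def)

lemma rhom_mon_val: "rhom h \<Longrightarrow> h (mon_val \<theta> m) = mon_val (\<lambda>v. h (\<theta> v)) m"
  by (simp add: mon_val_def rhom_prod rhom_power)

lemma poly_mapping_sum_single: "f = (\<Sum>m\<in>Poly_Mapping.keys f. Poly_Mapping.single m (Poly_Mapping.lookup f m))"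
proof (rule poly_mapping_eqI)
  fix k
  show "Poly_Mapping.lookup f k =
    Poly_Mapping.lookup (\<Sum>m\<in>Poly_Mapping.keys f. Poly_Mapping.single m (Poly_Mapping.lookup f m)) k"
    by (cases "k \<in> Poly_Mapping.keys f")
      (auto simp: lookup_sum lookup_single when_def in_keys_iff)
qed

lemma poly_mapping_add_induct [case_names zero single add]:
  fixes f :: "'a \<Rightarrow>\<^sub>0 'b::comm_monoid_add"
  assumes "P 0" "\<And>m c. P (Poly_Mapping.single m c)" "\<And>f g. P f \<Longrightarrow> P g \<Longrightarrow> P (f + g)"
  shows "P f"
proof -
  have "P (\<Sum>m\<in>Y. Poly_Mapping.single m (Poly_Mapping.lookup f m))" if "finite Y" for Y
    using that by induction (simp_all add: assms)
  from this[OF finite_keys, of f] show ?thesis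
    by (simp flip: poly_mapping_sum_single)
qed

lemma mp_subst_mon_val:
  "mp_subst h \<theta> f = (\<Sum>m\<in>Poly_Mapping.keys f. h (Poly_Mapping.lookup f m) * mon_val \<theta> m)"
  by (simp add: mp_subst_def mon_val_def)

lemma mp_subst_superset:
  assumes "h 0 = 0" "finite Y" "Poly_Mapping.keys f \<subseteq> Y"
  shows "mp_subst h \<theta> f = (\<Sum>m\<in>Y. h (Poly_Mapping.lookup f m) * mon_val \<theta> m)"
  unfolding mp_subst_mon_val using assms
  by (intro sum.mono_neutral_left) (auto simp: in_keys_iff)

lemma mp_subst_single:
  assumes "h 0 = 0"
  shows "mp_subst h \<theta> (Poly_Mapping.single m c) = h c * mon_val \<theta> m"
  by (cases "c = 0") (use assms in \<open>simp_all add: mp_subst_mon_val\<close>)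

lemma mp_subst_zero [simp]: "mp_subst h \<theta> 0 = 0"
  by (simp add: mp_subst_def)

lemma mp_subst_add:
  assumes "rhom h"
  shows "mp_subst h \<theta> (f + g) = mp_subst h \<theta> f + mp_subst h \<theta> g"
proof -
  let ?Y = "Poly_Mapping.keys f \<union> Poly_Mapping.keys g"
  have "Poly_Mapping.keys (f + g) \<subseteq> ?Y"
    by (rule Poly_Mapping.keys_add)
  then show ?thesis
    using assms
    by (simp add: mp_subst_superset[of h ?Y] rhom_simps lookup_add distrib_right sum.distrib)
qed

lemma mp_subst_mult:
  assumes "rhom h"
  shows "mp_subst h \<theta> (f * g) = mp_subst h \<theta> f * mp_subst h \<theta> g"
proof (induction f rule: poly_mapping_add_induct)
  case (single m c)
  show ?case
    by (induction g rule: poly_mapping_add_induct)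
      (simp_all add: mult_single mp_subst_single rhom_simps[OF assms] mon_val_add
        distrib_left distrib_right mp_subst_add[OF assms] mult_ac)
qed (simp_all add: distrib_right mp_subst_add[OF assms])

lemma rhom_mp_subst: "rhom h \<Longrightarrow> rhom (mp_subst h \<theta>)"
  by (rule rhomI) (simp_all add: mp_subst_add mp_subst_mult mp_subst_single rhom_simps flip: single_one)

lemma rhom_mp_const: "rhom mp_const"
  by (rule rhomI) (simp_all add: mp_const_def single_add mult_single)

lemma mp_subst_const': "rhom h \<Longrightarrow> mp_subst h \<theta> (mp_const c) = h c"
  by (simp add: mp_subst_const rhom_simps)

lemma mp_subst_var': "rhom h \<Longrightarrow> mp_subst h \<theta> (mp_var v) = \<theta> v"
  by (simp add: mp_subst_var rhom_simps)

lemma mp_subst_comp: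
  assumes "rhom \<phi>" "rhom h"
  shows "\<phi> (mp_subst h \<theta> f) = mp_subst (\<lambda>a. \<phi> (h a)) (\<lambda>v. \<phi> (\<theta> v)) f"
  using assms by (simp add: mp_subst_mon_val rhom_sum rhom_mult rhom_mon_val)

lemma single_eq_mon_val:
  fixes c :: "'k::comm_ring_1" and m :: "'v \<Rightarrow>\<^sub>0 nat"
  shows "Poly_Mapping.single m c = mp_const c * mon_val mp_var m"
proof -
  have *: "mon_val mp_var m = (Poly_Mapping.single m 1 :: ('v, 'k) mpoly)" for m :: "'v \<Rightarrow>\<^sub>0 nat"
  proof (induction m rule: poly_mapping_add_induct)
    case (single v k)
    have "(mp_var v :: ('v, 'k) mpoly) ^ k = Poly_Mapping.single (Poly_Mapping.single v k) 1"
      by (induction k) (simp_all add: mp_var_def mult_single flip: single_add)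
    then show ?case by simp
  qed (simp_all add: mon_val_add mult_single)
  show ?thesis
    by (simp add: * mp_const_def mult_single)
qed

text \<open>The subalgebra generated by \<open>V\<close>, given by closure rules instead of a
  condition on monomials, so that facts about ring homomorphisms follow by rule induction.\<close>

inductive_set polys :: "'v set \<Rightarrow> ('v, 'k::comm_ring_1) mpoly set" for V where
  const: "mp_const c \<in> polys V"
| var: "v \<in> V \<Longrightarrow> mp_var v \<in> polys V"
| add: "f \<in> polys V \<Longrightarrow> g \<in> polys V \<Longrightarrow> f + g \<in> polys V"
| mult: "f \<in> polys V \<Longrightarrow> g \<in> polys V \<Longrightarrow> f * g \<in> polys V"

lemma polys_mono: "V \<subseteq> W \<Longrightarrow> f \<in> polys V \<Longrightarrow> f \<in> polys W"
proof -
  assume "V \<subseteq> W"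
  show "f \<in> polys V \<Longrightarrow> f \<in> polys W"
    by (induction rule: polys.induct) (use \<open>V \<subseteq> W\<close> in \<open>auto intro: polys.intros\<close>)
qed

lemma polys_zero [simp]: "0 \<in> polys V" and polys_one [simp]: "1 \<in> polys V"
  using polys.const[of 0 V] polys.const[of 1 V] by (simp_all add: mp_const_def)

lemma polys_uminus: "f \<in> polys V \<Longrightarrow> - f \<in> polys V"
  using polys.mult[OF polys.const[of "-1" V], of f] by (simp add: mp_const_def single_uminus)

lemma polys_diff: "f \<in> polys V \<Longrightarrow> g \<in> polys V \<Longrightarrow> f - g \<in> polys V"
  using polys.add[OF _ polys_uminus] by fastforce

lemma polys_prod: "(\<And>i. i \<in> Y \<Longrightarrow> f i \<in> polys V) \<Longrightarrow> prod f Y \<in> polys V"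
  by (induction Y rule: infinite_finite_induct) (auto intro: polys.intros)

lemma polys_power: "f \<in> polys V \<Longrightarrow> f ^ n \<in> polys V"
  by (induction n) (auto intro: polys.intros)

lemma polys_finite: "\<exists>V. finite V \<and> f \<in> polys V"
proof (induction f rule: poly_mapping_add_induct)
  case (single m c)
  have "Poly_Mapping.single m c \<in> polys (Poly_Mapping.keys m)"
    unfolding single_eq_mon_val mon_val_def
    by (intro polys.intros polys_prod polys_power)
  then show ?case by (meson finite_keys)
next
  case (add f g)
  then obtain V W where "finite V" "f \<in> polys V" "finite W" "g \<in> polys W" by blast
  then have "f + g \<in> polys (V \<union> W)"
    by (intro polys.add) (auto elim: polys_mono[rotated])
  then show ?case
    using \<open>finite V\<close> \<open>finite W\<close> by blast
qed (use polys_zero in blast)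

text \<open>Every polynomial lies in some \<open>polys V\<close>; this is rule induction for
  \<open>polys\<close> with \<open>V\<close> hidden.\<close>

lemma mpoly_induct [case_names const var add mult]:
  assumes "\<And>c. P (mp_const c)" "\<And>v. P (mp_var v)"
    "\<And>f g. P f \<Longrightarrow> P g \<Longrightarrow> P (f + g)" "\<And>f g. P f \<Longrightarrow> P g \<Longrightarrow> P (f * g)"
  shows "P f"
proof -
  obtain V where "f \<in> polys V"
    using polys_finite by blast
  then show ?thesis
    by induction (simp_all add: assms)
qed

lemma rhom_eq_on_polys:
  assumes "rhom \<phi>" "rhom \<psi>" "f \<in> polys V"
    and "\<And>c. \<phi> (mp_const c) = \<psi> (mp_const c)" "\<And>v. v \<in> V \<Longrightarrow> \<phi> (mp_var v) = \<psi> (mp_var v)"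
  shows "\<phi> f = \<psi> f"
  using assms(3) by induction (simp_all add: assms rhom_simps)

lemma rhom_eqI:
  assumes "rhom \<phi>" "rhom \<psi>"
    and "\<And>c. \<phi> (mp_const c) = \<psi> (mp_const c)" "\<And>v. \<phi> (mp_var v) = \<psi> (mp_var v)"
  shows "\<phi> f = \<psi> f"
  using polys_finite[of f] rhom_eq_on_polys[OF assms(1,2) _ assms(3,4)] by blast

section \<open>Evaluation at points and the permutation action\<close>

definition mp_eval :: "('v \<Rightarrow> 'k::comm_ring_1) \<Rightarrow> ('v, 'k) mpoly \<Rightarrow> 'k" where
  "mp_eval = mp_subst id"

lemma rhom_mp_eval: "rhom (mp_eval q)"
  unfolding mp_eval_def by (rule rhom_mp_subst[OF rhom_id])

lemma mp_eval_simps [simp]: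
  "mp_eval q (f + g) = mp_eval q f + mp_eval q g"
  "mp_eval q (f * g) = mp_eval q f * mp_eval q g"
  "mp_eval q (f - g) = mp_eval q f - mp_eval q g"
  "mp_eval q (- f) = - mp_eval q f"
  "mp_eval q (f ^ n) = mp_eval q f ^ n"
  "mp_eval q 1 = 1"
  "mp_eval q (mp_const c) = c"
  "mp_eval q (mp_var v) = q v"
  by (simp_all add: rhom_simps[OF rhom_mp_eval])
    (simp_all add: mp_eval_def mp_subst_const' mp_subst_var' rhom_id)

lemma mp_eval_cong_polys:
  assumes "f \<in> polys V" "\<And>v. v \<in> V \<Longrightarrow> q v = q' v"
  shows "mp_eval q f = mp_eval q' f"
  by (rule rhom_eq_on_polys[OF rhom_mp_eval rhom_mp_eval assms(1)]) (simp_all add: assms)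

lemma rhom_perm_act: "rhom (perm_act \<sigma>)"
  unfolding perm_act_def by (rule rhom_mp_subst[OF rhom_mp_const])

lemma perm_act_const [simp]: "perm_act \<sigma> (mp_const c) = mp_const c"
  by (simp add: perm_act_def mp_subst_const' rhom_mp_const)

declare perm_act_var [simp]

lemma perm_act_comp: "perm_act \<sigma> (perm_act \<tau> f) = perm_act (\<sigma> \<circ> \<tau>) f"
  by (rule rhom_eqI[where \<phi> = "\<lambda>f. perm_act \<sigma> (perm_act \<tau> f)"])
    (auto intro: rhom_comp rhom_perm_act)

lemma perm_act_id: "perm_act id f = f"
proof (rule rhom_eqI[where \<psi> = "\<lambda>f. f"])
  fix v :: "nat \<times> 'a"
  show "perm_act id (mp_var v) = (mp_var v :: (nat \<times> 'a, 'b) mpoly)"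
    by (cases v) simp
qed (rule rhom_perm_act, simp_all add: rhom_def)

lemma mp_eval_perm_act: "mp_eval q (perm_act \<sigma> f) = mp_eval (\<lambda>(i, j). q (\<sigma> i, j)) f"
proof (rule rhom_eqI[where \<phi> = "\<lambda>f. mp_eval q (perm_act \<sigma> f)"])
  show "mp_eval q (perm_act \<sigma> (mp_var v)) = mp_eval (\<lambda>(i, j). q (\<sigma> i, j)) (mp_var v)" for v
    by (cases v) simp
qed (simp_all add: rhom_comp[OF rhom_mp_eval rhom_perm_act] rhom_mp_eval)

lemma perm_act_cong_polys:
  assumes "f \<in> polys (B \<times> UNIV)" "\<And>i. i \<in> B \<Longrightarrow> \<sigma> i = \<tau> i"
  shows "perm_act \<sigma> f = perm_act \<tau> f"
  by (rule rhom_eq_on_polys[OF rhom_perm_act rhom_perm_act assms(1)]) (auto simp: assms)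

lemma polys_perm_act:
  assumes "f \<in> polys (B \<times> UNIV)"
  shows "perm_act \<sigma> f \<in> polys ((\<sigma> ` B) \<times> UNIV)"
  using assms
proof induction
  case (var v)
  then show ?case
    by (cases v) (auto intro: polys.var)
qed (auto intro: polys.intros simp: rhom_simps[OF rhom_perm_act])

section \<open>Prime ideals and orbit closures\<close>

text \<open>Unpacks the record-based \<open>primeideal\<close> into closure conditions. Negation is
  not listed, being multiplication by -1; \<open>1 \<notin> P\<close> expresses properness.\<close>

lemma Spec_iff:
  "P \<in> Spec \<longleftrightarrow> 0 \<in> P \<and> (\<forall>a b. a \<in> P \<longrightarrow> b \<in> P \<longrightarrow> a + b \<in> P) \<and> (\<forall>a c. a \<in> P \<longrightarrow> c * a \<in> P)
     \<and> 1 \<notin> P \<and> (\<forall>a b. a * b \<in> P \<longrightarrow> a \<in> P \<or> b \<in> P)" (is "_ \<longleftrightarrow> ?R")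
proof
  assume "P \<in> Spec"
  then interpret primeideal P "ring_of_type_algebra :: 'a ring"
    by (simp add: Spec_def)
  have mult: "c * a \<in> P" if "a \<in> P" for a c
    using I_l_closed[of a c] that by (simp add: ring_of_type_algebra_def)
  moreover have "1 \<notin> P"
  proof
    assume "1 \<in> P"
    then have "P = UNIV"
      using mult[of 1] by auto
    then show False
      using I_notcarr by (simp add: ring_of_type_algebra_def)
  qed
  moreover have "0 \<in> P" "a \<in> P \<Longrightarrow> b \<in> P \<Longrightarrow> a + b \<in> P" "a * b \<in> P \<Longrightarrow> a \<in> P \<or> b \<in> P" for a b
    using additive_subgroup.zero_closed[OF is_additive_subgroup]
      additive_subgroup.a_closed[OF is_additive_subgroup, of a b] I_prime[of a b] by (simp_all add: ring_of_type_algebra_def)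
  ultimately show ?R by blast
next
  assume R: ?R
  let ?A = "ring_of_type_algebra :: 'a ring"
  have neg: "- a \<in> P" if "a \<in> P" for a
    using R that by (metis mult_minus1)
  have sub: "subgroup P (add_monoid ?A)"
  proof (rule subgroup.intro)
    show "inv\<^bsub>add_monoid ?A\<^esub> x \<in> P" if "x \<in> P" for x
    proof -
      have "inv\<^bsub>add_monoid ?A\<^esub> x = - x"
        by (rule group.inv_equality)
          (auto simp: ring_of_type_algebra_def intro!: groupI exI[of _ "- x" for x])
      then show ?thesis
        using neg that by simp
    qed
  qed (use R in \<open>auto simp: ring_of_type_algebra_def\<close>)
  have "ideal P ?A"
    by (rule idealI[OF ring_from_type_algebra sub])
      (use R in \<open>auto simp: ring_of_type_algebra_def mult.commute\<close>)
  then have "primeideal P ?A"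
    by (rule primeidealI[OF _ cring_from_type_algebra]) (use R in \<open>auto simp: ring_of_type_algebra_def\<close>)
  then show "P \<in> Spec"
    by (simp add: Spec_def)
qed

lemma Spec_zero: "P \<in> Spec \<Longrightarrow> 0 \<in> P"
  and Spec_add: "P \<in> Spec \<Longrightarrow> a \<in> P \<Longrightarrow> b \<in> P \<Longrightarrow> a + b \<in> P"
  and Spec_mult: "P \<in> Spec \<Longrightarrow> a \<in> P \<Longrightarrow> c * a \<in> P"
  and Spec_mult': "P \<in> Spec \<Longrightarrow> a \<in> P \<Longrightarrow> a * c \<in> P"
  and Spec_one: "P \<in> Spec \<Longrightarrow> 1 \<notin> P"
  and Spec_prime: "P \<in> Spec \<Longrightarrow> a * b \<in> P \<longleftrightarrow> a \<in> P \<or> b \<in> P"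
  unfolding Spec_iff by (auto simp: mult.commute)

lemma Spec_uminus: "P \<in> Spec \<Longrightarrow> a \<in> P \<Longrightarrow> - a \<in> P"
  by (metis Spec_mult mult_minus1)

lemma Spec_diff: "P \<in> Spec \<Longrightarrow> a \<in> P \<Longrightarrow> b \<in> P \<Longrightarrow> a - b \<in> P"
  using Spec_add[OF _ _ Spec_uminus, of P a b] by simp

lemma Spec_sum: "P \<in> Spec \<Longrightarrow> (\<And>i. i \<in> Y \<Longrightarrow> f i \<in> P) \<Longrightarrow> sum f Y \<in> P"
  by (induction Y rule: infinite_finite_induct) (auto simp: Spec_zero Spec_add)

lemma Spec_prod: "P \<in> Spec \<Longrightarrow> finite Y \<Longrightarrow> prod f Y \<in> P \<longleftrightarrow> (\<exists>i\<in>Y. f i \<in> P)"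
  by (induction Y rule: infinite_finite_induct) (auto simp: Spec_prime Spec_one)

lemma Spec_power: "P \<in> Spec \<Longrightarrow> a ^ n \<in> P \<Longrightarrow> a \<in> P"
  by (induction n) (auto simp: Spec_prime Spec_one)

lemma Spec_vimage:
  assumes "P \<in> Spec" "rhom h"
  shows "{a. h a \<in> P} \<in> Spec"
  using assms(1) unfolding Spec_iff by (simp add: rhom_simps[OF assms(2)])

lemma Sym_infty_inv:
  assumes "\<sigma> \<in> Sym_infty"
  shows "inv_into UNIV \<sigma> \<in> Sym_infty" "\<sigma> \<circ> inv_into UNIV \<sigma> = id" "inv_into UNIV \<sigma> \<circ> \<sigma> = id" "inj \<sigma>"
  using assms unfolding Sym_infty_def
  by (auto simp: permutes_inv_o permutes_inj intro: permutes_inv)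

text \<open>As a preimage under the inverse permutation, the image of a prime is prime by
  \<open>Spec_vimage\<close>.\<close>

lemma perm_act_image:
  assumes "\<sigma> \<in> Sym_infty"
  shows "perm_act \<sigma> ` y = {f. perm_act (inv_into UNIV \<sigma>) f \<in> y}"
proof safe
  fix f assume "f \<in> y"
  then show "perm_act (inv_into UNIV \<sigma>) (perm_act \<sigma> f) \<in> y"
    by (simp only: perm_act_comp Sym_infty_inv[OF assms] perm_act_id)
next
  fix f assume "perm_act (inv_into UNIV \<sigma>) f \<in> y"
  moreover have "f = perm_act \<sigma> (perm_act (inv_into UNIV \<sigma>) f)"
    by (simp only: perm_act_comp Sym_infty_inv[OF assms] perm_act_id)
  ultimately show "f \<in> perm_act \<sigma> ` y"
    by blast
qed

text \<open>Zero loci are closed, so vanishing on the closure means vanishing on the orbit. An orbit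
  point contains \<open>f\<close> iff the inverse permutation moves \<open>f\<close> into
  \<open>y\<close>, and \<open>Sym_infty\<close> is closed under inverses.\<close>

lemma vanishing_ideal_orbit_closure:
  assumes "y \<in> Spec"
  shows "vanishing_ideal (orbit_closure y) = {f. \<forall>\<sigma>\<in>Sym_infty. perm_act \<sigma> f \<in> y}"
proof safe
  fix f \<sigma> assume f: "f \<in> vanishing_ideal (orbit_closure y)" and \<sigma>: "\<sigma> \<in> Sym_infty"
  have "point_orbit y \<subseteq> topspace zariski"
    using assms by (auto simp: point_orbit_def topspace_zariski perm_act_image Spec_vimage rhom_perm_act)
  then have "point_orbit y \<subseteq> orbit_closure y"
    unfolding orbit_closure_def by (rule closure_of_subset)
  moreover have "perm_act (inv_into UNIV \<sigma>) ` y \<in> point_orbit y"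
    using Sym_infty_inv(1)[OF \<sigma>] by (auto simp: point_orbit_def)
  ultimately have "f \<in> perm_act (inv_into UNIV \<sigma>) ` y"
    using f by (auto simp: vanishing_ideal_def)
  moreover have "inv_into UNIV (inv_into UNIV \<sigma>) = \<sigma>"
    using \<sigma> by (auto simp: Sym_infty_def permutes_inv_inv)
  ultimately show "perm_act \<sigma> f \<in> y"
    using perm_act_image[OF Sym_infty_inv(1)[OF \<sigma>], of y] by auto
next
  fix f assume f: "\<forall>\<sigma>\<in>Sym_infty. perm_act \<sigma> f \<in> y"
  have "closedin zariski (zero_locus {f})"
    unfolding closedin_zariski by blast
  moreover have "point_orbit y \<subseteq> zero_locus {f}"
    using f assms Sym_infty_inv(1)
    by (auto simp: point_orbit_def zero_locus_def perm_act_image Spec_vimage rhom_perm_act)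
  ultimately have "orbit_closure y \<subseteq> zero_locus {f}"
    unfolding orbit_closure_def by (rule closure_of_minimal[rotated])
  then show "f \<in> vanishing_ideal (orbit_closure y)"
    by (auto simp: vanishing_ideal_def zero_locus_def)
qed

text \<open>Inside a large segment \<open>{..<k}\<close> the complements of \<open>W\<close> and of
  its image have equal size; any bijection between them, and the identity from \<open>k\<close> on,
  complete the permutation.\<close>

lemma Sym_infty_extension:
  assumes "finite W" "inj_on \<rho> W"
  shows "\<exists>\<sigma>\<in>Sym_infty. \<forall>i\<in>W. \<sigma> i = \<rho> i"
proof -
  obtain k where k: "W \<union> \<rho> ` W \<subseteq> {..<k}"
    using finite_nat_bounded[of "W \<union> \<rho> ` W"] assms(1) by auto
  have "card ({..<k} - W) = card ({..<k} - \<rho> ` W)"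
    using k assms by (simp add: card_Diff_subset card_image)
  then obtain g where g: "bij_betw g ({..<k} - W) ({..<k} - \<rho> ` W)"
    using finite_same_card_bij[of "{..<k} - W" "{..<k} - \<rho> ` W"] by auto
  define \<sigma> where "\<sigma> i = (if i \<in> W then \<rho> i else if i < k then g i else i)" for i
  have "bij_betw \<sigma> (W \<union> ({..<k} - W)) (\<rho> ` W \<union> ({..<k} - \<rho> ` W))"
  proof (rule bij_betw_combine)
    show "bij_betw \<sigma> W (\<rho> ` W)"
      using assms(2) by (auto simp: bij_betw_def \<sigma>_def inj_on_def)
    show "bij_betw \<sigma> ({..<k} - W) ({..<k} - \<rho> ` W)"
      using g by (rule iffD1[OF bij_betw_cong, rotated]) (auto simp: \<sigma>_def)
  qed auto
  then have "bij_betw \<sigma> {..<k} {..<k}"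
    using k by (simp add: Un_absorb1 Un_Diff_cancel)
  then have "\<sigma> permutes {..<k}"
    using k by (intro bij_imp_permutes) (auto simp: \<sigma>_def)
  then have "\<sigma> \<in> Sym_infty"
    by (auto simp: Sym_infty_def)
  then show ?thesis
    by (intro bexI[of _ \<sigma>]) (auto simp: \<sigma>_def)
qed

text \<open>Only the blocks in \<open>W\<close> matter for \<open>f\<close>, so a map injective on
  \<open>W\<close> acts on it like some finite permutation.\<close>

lemma perm_act_mem_of_inj:
  assumes "\<forall>\<sigma>\<in>Sym_infty. perm_act \<sigma> f \<in> y" "f \<in> polys (W \<times> UNIV)" "finite W" "inj_on \<rho> W"
  shows "perm_act \<rho> f \<in> y"
  using Sym_infty_extension[OF assms(3,4)] assms(1) perm_act_cong_polys[OF assms(2)] by metis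

section \<open>A Nullstellensatz in countably many variables\<close>

definition poly_at :: "('v, 'k::comm_ring_1) mpoly \<Rightarrow> 'k poly \<Rightarrow> ('v, 'k) mpoly" where
  "poly_at z p = poly (map_poly mp_const p) z"

lemma poly_at_pCons [simp]: "poly_at z (pCons a p) = mp_const a + z * poly_at z p"
  and poly_at_0 [simp]: "poly_at z 0 = 0"
  by (simp_all add: poly_at_def map_poly_pCons rhom_simps[OF rhom_mp_const])

lemma poly_at_add: "poly_at z (p + q) = poly_at z p + poly_at z q"
proof (induction p arbitrary: q)
  case (pCons a p)
  obtain b q' where "q = pCons b q'"
    by (cases q)
  then show ?case
    by (simp add: pCons.IH rhom_simps[OF rhom_mp_const] algebra_simps)
qed simp

lemma poly_at_smult: "poly_at z (smult c p) = mp_const c * poly_at z p"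
  by (induction p) (simp_all add: rhom_simps[OF rhom_mp_const] algebra_simps)

lemma poly_at_mult: "poly_at z (p * q) = poly_at z p * poly_at z q"
  by (induction p)
    (simp_all add: poly_at_add poly_at_smult rhom_simps[OF rhom_mp_const] algebra_simps)

lemma rhom_poly_at: "rhom (poly_at z)"
  by (rule rhomI) (simp_all add: poly_at_add poly_at_mult rhom_simps[OF rhom_mp_const] flip: one_pCons
      del: poly_at_pCons, simp add: one_pCons rhom_simps[OF rhom_mp_const])

lemma Spec_const:
  fixes M :: "('v, 'k::field) mpoly set"
  assumes "M \<in> Spec"
  shows "mp_const c \<in> M \<longleftrightarrow> c = 0"
proof
  assume "mp_const c \<in> M"
  then have "mp_const (inverse c) * mp_const c \<in> M"
    by (rule Spec_mult[OF assms])
  then show "c = 0"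
    using Spec_one[OF assms] rhom_mp_const by (metis left_inverse rhom_mult rhom_one)
qed (simp add: rhom_simps[OF rhom_mp_const] Spec_zero[OF assms])

text \<open>A monomial is determined by the finite set of its pairs of a variable and a positive
  exponent.\<close>

lemma countable_monomials: "countable (UNIV :: ('v::countable \<Rightarrow>\<^sub>0 nat) set)"
proof -
  let ?g = "\<lambda>m :: 'v \<Rightarrow>\<^sub>0 nat. (\<lambda>v. (v, Poly_Mapping.lookup m v)) ` Poly_Mapping.keys m"
  have "inj ?g"
  proof (rule injI, rule poly_mapping_eqI)
    fix m m' v assume eq: "?g m = ?g m'"
    have "Poly_Mapping.lookup m v = k \<longleftrightarrow> (v, k) \<in> ?g m" if "k > 0" for m :: "'v \<Rightarrow>\<^sub>0 nat" and k
      using that by (auto simp: in_keys_iff)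
    with eq show "Poly_Mapping.lookup m v = Poly_Mapping.lookup m' v"
      by (metis gr0I)
  qed
  moreover have "countable (range ?g)"
    by (rule countable_subset[OF _ countable_Collect_finite]) auto
  ultimately show ?thesis
    by (rule countable_image_inj_on[rotated])
qed

text \<open>
  An ideal that is maximal among those containing no power of \<open>h\<close> is prime, and every
  element outside it divides a power of \<open>h\<close> modulo it.
\<close>

lemma exists_prime_avoiding:
  fixes y :: "'a::comm_ring_1 set"
  assumes y: "y \<in> Spec" and h: "h \<notin> y"
  shows "\<exists>M\<in>Spec. y \<subseteq> M \<and> h \<notin> M \<and> (\<forall>a. a \<notin> M \<longrightarrow> (\<exists>n b. h ^ n - b * a \<in> M))"
proof -
  define ideals where "ideals = {M :: 'a set. 0 \<in> M \<and> (\<forall>a b. a \<in> M \<longrightarrow> b \<in> M \<longrightarrow> a + b \<in> M)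
    \<and> (\<forall>a c. a \<in> M \<longrightarrow> c * a \<in> M) \<and> y \<subseteq> M \<and> (\<forall>n. h ^ n \<notin> M)}"
  have "y \<in> ideals"
    using Spec_zero[OF y] Spec_add[OF y] Spec_mult[OF y] Spec_power[OF y] h
    by (auto simp: ideals_def)
  moreover have "\<Union>\<C> \<in> ideals" if ne: "\<C> \<noteq> {}" and ch: "subset.chain ideals \<C>" for \<C>
  proof -
    have sub: "\<C> \<subseteq> ideals" and tot: "\<And>A B. A \<in> \<C> \<Longrightarrow> B \<in> \<C> \<Longrightarrow> A \<subseteq> B \<or> B \<subseteq> A"
      using ch by (auto simp: subset_chain_def)
    have "a + b \<in> \<Union>\<C>" if ab: "a \<in> \<Union>\<C>" "b \<in> \<Union>\<C>" for a b
    proof -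
      obtain A B where "A \<in> \<C>" "a \<in> A" "B \<in> \<C>" "b \<in> B"
        using ab by blast
      moreover have "\<And>N. N \<in> \<C> \<Longrightarrow> a \<in> N \<Longrightarrow> b \<in> N \<Longrightarrow> a + b \<in> N"
        using sub by (auto simp: ideals_def)
      ultimately show ?thesis
        using tot[of A B] by blast
    qed
    then show ?thesis
      using ne sub unfolding ideals_def by blast
  qed
  ultimately obtain M where M: "M \<in> ideals" and max: "\<And>N. N \<in> ideals \<Longrightarrow> M \<subseteq> N \<Longrightarrow> N = M"
    using subset_Zorn_nonempty[of ideals] by blast
  from M have M0: "0 \<in> M" and Madd: "\<And>a b. a \<in> M \<Longrightarrow> b \<in> M \<Longrightarrow> a + b \<in> M"
    and Mmult: "\<And>a c. a \<in> M \<Longrightarrow> c * a \<in> M" and yM: "y \<subseteq> M" and hM: "\<And>n. h ^ n \<notin> M"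
    by (auto simp: ideals_def)
  have div: "\<exists>n b. h ^ n - b * a \<in> M" if a: "a \<notin> M" for a
  proof (rule ccontr)
    assume no: "\<nexists>n b. h ^ n - b * a \<in> M"
    \<comment> \<open>\<open>N\<close> is the ideal generated by \<open>M\<close> and
      \<open>a\<close>. If it contained no power of \<open>h\<close>, maximality would put
      \<open>a\<close> into \<open>M\<close>.\<close>
    define N where "N = {x. \<exists>b. x - b * a \<in> M}"
    have MN: "M \<subseteq> N"
      unfolding N_def by (metis (no_types, lifting) diff_zero mem_Collect_eq mult_zero_left subsetI)
    have "N \<in> ideals"
      unfolding ideals_def
    proof (intro CollectI conjI allI impI)
      fix x x' assume "x \<in> N" "x' \<in> N"
      then obtain b b' where "x - b * a \<in> M" "x' - b' * a \<in> M"
        by (auto simp: N_def)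
      then have "(x + x') - (b + b') * a \<in> M"
        using Madd[of "x - b * a" "x' - b' * a"] by (simp add: algebra_simps)
      then show "x + x' \<in> N"
        by (auto simp: N_def)
    next
      fix x c assume "x \<in> N"
      then obtain b where "x - b * a \<in> M"
        by (auto simp: N_def)
      then have "c * x - (c * b) * a \<in> M"
        using Mmult[of "x - b * a" c] by (simp add: algebra_simps)
      then show "c * x \<in> N"
        by (auto simp: N_def)
    next
      show "0 \<in> N" "y \<subseteq> N"
        using MN M0 yM by blast+
      show "h ^ n \<notin> N" for n
        using no by (auto simp: N_def)
    qed
    then have "N = M"
      using max MN by blast
    moreover have "a \<in> N"
      using M0 by (auto simp: N_def intro!: exI[of _ 1])
    ultimately show False
      using a by simp
  qed
  have "a \<in> M \<or> b \<in> M" if ab: "a * b \<in> M" for a b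
  proof (rule ccontr)
    assume "\<not> ?thesis"
    then obtain n m s t where *: "h ^ n - s * a \<in> M" "h ^ m - t * b \<in> M"
      using div by blast
    have "h ^ (n + m) = h ^ m * (h ^ n - s * a) + (s * a) * (h ^ m - t * b) + (s * t) * (a * b)"
      by (simp add: algebra_simps power_add)
    then show False
      using Madd Mmult * ab hM by metis
  qed
  then have "M \<in> Spec"
    unfolding Spec_iff using M0 Madd Mmult hM[of 0] by auto
  moreover have "h \<notin> M"
    using hM[of 1] by simp
  ultimately show ?thesis
    using yM div by blast
qed

text \<open>
  If no \<open>z - c\<close> lay in \<open>M\<close>, their uncountably many inverses (up to powers of \<open>h\<close>) would be
  linearly dependent in a space of countable dimension; clearing denominators in the
  dependency gives a nonzero polynomial in \<open>z\<close> that lies in \<open>M\<close>.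
\<close>

lemma exists_value_mod:
  fixes M :: "('v::countable, 'k::alg_closed_field) mpoly set"
  assumes unc: "uncountable (UNIV :: 'k set)"
    and M: "M \<in> Spec" and h: "h \<notin> M" and div: "\<And>a. a \<notin> M \<Longrightarrow> \<exists>n b. h ^ n - b * a \<in> M"
  shows "\<exists>c. z - mp_const c \<in> M"
proof (rule ccontr)
  assume no: "\<nexists>c. z - mp_const c \<in> M"
  then have "\<forall>c. \<exists>n b. h ^ n - b * (z - mp_const c) \<in> M"
    using div by blast
  then obtain N U where NU: "\<And>c. h ^ N c - U c * (z - mp_const c) \<in> M"
    by metis
  have ring: "a * r * (H - b * w) = H * (a * r) - (w * r) * (a * b)" for a r H b w :: "('v, 'k) mpoly"
    by (simp add: algebra_simps)
  interpret vector_space "\<lambda>c (f :: ('v, 'k) mpoly). mp_const c * f"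
    by unfold_locales (simp_all add: rhom_simps[OF rhom_mp_const] algebra_simps)
  \<comment> \<open>\<open>e\<close> enumerates the monomials, a countable basis; \<open>k c\<close>
    bounds the part of it that \<open>U c\<close> uses.\<close>
  obtain e :: "nat \<Rightarrow> 'v \<Rightarrow>\<^sub>0 nat" where e: "surj e"
    using from_nat_into_surj[OF countable_monomials] that unfolding surj_def by (metis UNIV_I)
  have "\<exists>k. Poly_Mapping.keys (U c) \<subseteq> e ` {..<k}" for c
  proof -
    have "Poly_Mapping.keys (U c) \<subseteq> e ` UNIV"
      using e by simp
    then obtain Y where "finite Y" "Poly_Mapping.keys (U c) = e ` Y"
      by (metis finite_keys finite_subset_image)
    then show ?thesis
      using finite_nat_bounded[of Y] by (metis image_mono)
  qed
  then obtain k where k: "\<And>c. Poly_Mapping.keys (U c) \<subseteq> e ` {..<k c}"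
    by metis
  \<comment> \<open>Pigeonhole: uncountably many \<open>c\<close> share only countably many pairs
    \<open>(N c, k c)\<close>.\<close>
  have "\<exists>n l. infinite {c. N c = n \<and> k c = l}"
  proof (rule ccontr)
    assume "\<not> ?thesis"
    then have "countable (\<Union>(n, l)\<in>UNIV. {c. N c = n \<and> k c = l})"
      by (intro countable_UN) (auto intro: countable_finite)
    moreover have "(\<Union>(n, l)\<in>UNIV. {c. N c = n \<and> k c = l}) = UNIV"
      by auto
    ultimately show False
      using unc by simp
  qed
  then obtain n l where inf: "infinite {c. N c = n \<and> k c = l}"
    by blast
  define C where "C = {c. N c = n \<and> k c = l}"
  define T where "T = (\<lambda>m. Poly_Mapping.single m 1 :: ('v, 'k) mpoly) ` e ` {..<l}"
  have C: "h ^ n - U c * (z - mp_const c) \<in> M" if "c \<in> C" for c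
    using NU[of c] that by (simp add: C_def)
  have in_span: "U c \<in> span T" if "c \<in> C" for c
  proof -
    have "U c = (\<Sum>m\<in>Poly_Mapping.keys (U c). mp_const (Poly_Mapping.lookup (U c) m) * Poly_Mapping.single m 1)"
      by (subst poly_mapping_sum_single) (simp add: mp_const_def mult_single)
    also have "\<dots> \<in> span T"
      using k[of c] that by (intro span_sum span_scale span_base) (auto simp: T_def C_def)
    finally show ?thesis .
  qed
  \<comment> \<open>Equal witnesses for distinct \<open>c\<close> and \<open>d\<close> would put
    \<open>U c\<close> times a nonzero constant into \<open>M\<close>, hence \<open>U c\<close> and
    then \<open>h ^ n\<close>.\<close>
  have inj: "inj_on U C"
  proof (rule inj_onI, rule ccontr)
    fix c d assume c: "c \<in> C" and d: "d \<in> C" and eq: "U c = U d" and "c \<noteq> d"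
    have "U c * mp_const (c - d) = (h ^ n - U c * (z - mp_const c)) - (h ^ n - U d * (z - mp_const d))"
      unfolding eq by (simp add: algebra_simps rhom_simps[OF rhom_mp_const])
    then have "U c * mp_const (c - d) \<in> M"
      using Spec_diff[OF M C[OF c] C[OF d]] by simp
    then have "U c \<in> M"
      using \<open>c \<noteq> d\<close> by (simp add: Spec_prime[OF M] Spec_const[OF M])
    then have "U c * (z - mp_const c) \<in> M"
      by (rule Spec_mult'[OF M])
    then have "h ^ n \<in> M"
      using Spec_add[OF M C[OF c]] by fastforce
    then show False
      using h Spec_power[OF M] by blast
  qed
  have "infinite (U ` C)"
    using inf inj unfolding C_def by (simp add: finite_image_iff)
  then have "dependent (U ` C)"
    using independent_span_bound[of T "U ` C"] in_span by (auto simp: T_def)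
  then obtain t u v where t: "finite t" "t \<subseteq> U ` C" "v \<in> t" "u v \<noteq> 0"
    and dep: "(\<Sum>v\<in>t. mp_const (u v) * v) = 0"
    unfolding dependent_explicit by blast
  obtain C' where C': "C' \<subseteq> C" "finite C'" "t = U ` C'"
    using t by (metis finite_subset_image)
  \<comment> \<open>As in Lagrange interpolation, \<open>r c\<close> vanishes on the rest of
    \<open>C'\<close> but not at \<open>c\<close>, so evaluation at \<open>c0\<close> isolates a
    nonzero coefficient of the dependency.\<close>
  define r where "r c = (\<Prod>d\<in>C' - {c}. [:- d, 1:])" for c :: 'k
  define \<Phi> where "\<Phi> = (\<Sum>c\<in>C'. smult (u (U c)) (r c))"
  obtain c0 where c0: "c0 \<in> C'" "u (U c0) \<noteq> 0"
    using t C' by auto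
  have "poly \<Phi> c0 = (\<Sum>c\<in>C'. u (U c) * poly (r c) c0)"
    by (simp add: \<Phi>_def poly_sum)
  also have "\<dots> = (\<Sum>c\<in>{c0}. u (U c) * poly (r c) c0)"
    using c0 C'(2) by (intro sum.mono_neutral_right) (auto simp: r_def poly_prod)
  also have "\<dots> \<noteq> 0"
    using c0 C'(2) by (auto simp: r_def poly_prod)
  finally have "\<Phi> \<noteq> 0"
    by auto
  then obtain A where A: "\<Phi> = smult (lead_coeff \<Phi>) (\<Prod>x\<in>#A. [:- x, 1:])"
    using alg_closed_imp_factorization by blast
  \<comment> \<open>By algebraic closedness \<Phi> splits into linear factors; by assumption none of
    them lies in \<open>M\<close> after substituting \<open>z\<close>.\<close>
  have "poly_at z (\<Prod>x\<in>#A. [:- x, 1:]) \<notin> M"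
  proof (induction A)
    case (add c A)
    have "mp_const (- c) + z \<notin> M"
      using no by (metis add.commute diff_conv_add_uminus rhom_minus rhom_mp_const)
    moreover have "poly_at z (\<Prod>x\<in>#add_mset c A. [:- x, 1:]) =
        (mp_const (- c) + z) * poly_at z (\<Prod>x\<in>#A. [:- x, 1:])"
      unfolding image_mset_add_mset prod_mset.add_mset poly_at_mult
      by (simp add: rhom_simps[OF rhom_mp_const])
    ultimately show ?case
      using add by (simp add: Spec_prime[OF M])
  qed (simp add: rhom_simps[OF rhom_poly_at] Spec_one[OF M])
  then have \<Phi>M: "poly_at z \<Phi> \<notin> M"
    by (subst A) (simp add: poly_at_smult Spec_prime[OF M] Spec_const[OF M] \<open>\<Phi> \<noteq> 0\<close>)
  define p where "p = (\<Prod>d\<in>C'. z - mp_const d)"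
  have r_at: "(z - mp_const c) * poly_at z (r c) = p" if "c \<in> C'" for c
  proof -
    have "poly_at z (r c) = (\<Prod>d\<in>C' - {c}. z - mp_const d)"
      by (simp add: r_def rhom_prod[OF rhom_poly_at] rhom_simps[OF rhom_mp_const])
    then show ?thesis
      using that C'(2) by (simp add: p_def prod.remove)
  qed
  \<comment> \<open>The congruences are multiplied by the cofactors \<open>r c\<close> at
    \<open>z\<close>, weighted and summed. The \<open>U c\<close> parts share the factor
    \<open>p\<close> and cancel by the dependency.\<close>
  have "(\<Sum>c\<in>C'. mp_const (u (U c)) * poly_at z (r c) * (h ^ n - U c * (z - mp_const c))) \<in> M"
    by (intro Spec_sum[OF M] Spec_mult[OF M] C) (use C' in auto)
  also have "(\<Sum>c\<in>C'. mp_const (u (U c)) * poly_at z (r c) * (h ^ n - U c * (z - mp_const c))) =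
      (\<Sum>c\<in>C'. h ^ n * (mp_const (u (U c)) * poly_at z (r c)) - p * (mp_const (u (U c)) * U c))"
    by (intro sum.cong refl) (simp only: ring r_at)
  also have "\<dots> = h ^ n * poly_at z \<Phi> - p * (\<Sum>v\<in>t. mp_const (u v) * v)"
    using inj_on_subset[OF inj C'(1)]
    by (simp add: \<Phi>_def C'(3) sum.reindex sum_subtractf sum_distrib_left rhom_sum[OF rhom_poly_at] poly_at_smult)
  finally have "h ^ n * poly_at z \<Phi> \<in> M"
    using dep by simp
  then show False
    using \<Phi>M h Spec_power[OF M] by (auto simp: Spec_prime[OF M])
qed

text \<open>Modulo the prime \<open>M\<close> each variable is congruent to a constant, so every
  polynomial is congruent to its value at the point \<open>q\<close> of these constants. Since
  \<open>M\<close> contains no nonzero constant, membership in \<open>M\<close> means vanishing at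
  \<open>q\<close>.\<close>

theorem countable_nullstellensatz:
  fixes y :: "('v::countable, 'k::alg_closed_field) mpoly set"
  assumes unc: "uncountable (UNIV :: 'k set)" and y: "y \<in> Spec" and h: "h \<notin> y"
  shows "\<exists>q. (\<forall>f\<in>y. mp_eval q f = 0) \<and> mp_eval q h \<noteq> 0"
proof -
  obtain M where M: "M \<in> Spec" "y \<subseteq> M" "h \<notin> M" and div: "\<And>a. a \<notin> M \<Longrightarrow> \<exists>n b. h ^ n - b * a \<in> M"
    using exists_prime_avoiding[OF y h] by blast
  have "\<forall>v. \<exists>c. mp_var v - mp_const c \<in> M"
    by (intro allI exists_value_mod[OF unc M(1,3)] div)
  then obtain q where q: "\<And>v. mp_var v - mp_const (q v) \<in> M"
    by metis
  have eval: "f - mp_const (mp_eval q f) \<in> M" for f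
  proof (induction f rule: mpoly_induct)
    case (add f g)
    then show ?case
      using Spec_add[OF M(1) add] by (simp add: rhom_simps[OF rhom_mp_const] algebra_simps)
  next
    case (mult f g)
    have "f * g - mp_const (mp_eval q (f * g)) =
        g * (f - mp_const (mp_eval q f)) + mp_const (mp_eval q f) * (g - mp_const (mp_eval q g))"
      by (simp add: rhom_simps[OF rhom_mp_const] algebra_simps)
    then show ?case
      using mult Spec_add[OF M(1)] Spec_mult[OF M(1)] by metis
  qed (simp_all add: q Spec_zero[OF M(1)])
  have "mp_eval q f = 0" if "f \<in> M" for f
    using Spec_diff[OF M(1) that eval[of f]] by (simp add: Spec_const[OF M(1)])
  moreover have "mp_eval q h \<noteq> 0"
    using eval[of h] M(3) by (auto simp: rhom_simps[OF rhom_mp_const])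
  ultimately show ?thesis
    using M(2) by blast
qed

section \<open>Bases of block ideals modulo a prime\<close>

text \<open>A monomial order, read off from the numbers \<open>\<Prod>j. p j ^ m j\<close> for distinct primes \<open>p j\<close>.\<close>

lemma exists_monomial_rank:
  "\<exists>r :: ('n::finite \<Rightarrow>\<^sub>0 nat) \<Rightarrow> nat. inj r \<and> (\<forall>a b c. r a < r b \<longrightarrow> r (a + c) < r (b + c))"
proof -
  obtain S :: "nat set" where S: "finite S" "card S = CARD('n)" "S \<subseteq> {p. normalization_semidom_class.prime p}"
    using infinite_arbitrarily_large[OF primes_infinite] by blast
  then obtain p :: "'n \<Rightarrow> nat" where "bij_betw p UNIV S"
    by (metis finite_same_card_bij finite)
  then have inj: "inj p" and prime: "\<And>j. normalization_semidom_class.prime (p j)"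
    using S(3) by (auto simp: bij_betw_def)
  define r where "r m = (\<Prod>j\<in>UNIV. p j ^ Poly_Mapping.lookup m j)" for m :: "'n \<Rightarrow>\<^sub>0 nat"
  \<comment> \<open>Unique factorization recovers the exponents, which makes \<open>r\<close>
    injective; compatibility with addition comes from \<open>r\<close> being multiplicative and
    positive.\<close>
  have mult: "multiplicity (p j) (r m) = Poly_Mapping.lookup m j" for m j
  proof -
    have "r m = (\<Prod>q\<in>range p. q ^ Poly_Mapping.lookup m (inv_into UNIV p q))"
      by (simp add: r_def prod.reindex[OF inj] inj)
    moreover have "multiplicity (p j) (\<Prod>q\<in>range p. q ^ Poly_Mapping.lookup m (inv_into UNIV p q)) =
        Poly_Mapping.lookup m (inv_into UNIV p (p j))"
      by (subst multiplicity_prod_prime_powers) (use prime in auto)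
    ultimately show ?thesis
      by (simp add: inj)
  qed
  have "inj r"
    by (metis injI mult poly_mapping_eqI)
  moreover have "r (a + c) = r a * r c" for a c
    by (simp add: r_def lookup_add power_add prod.distrib)
  moreover have "r c > 0" for c
    using prime by (auto simp: r_def prime_gt_0_nat intro!: prod_pos)
  ultimately show ?thesis
    by (intro exI[of _ r]) simp
qed

text \<open>There is a monotone subsequence, and a decreasing one of natural numbers is constant
  once its minimum is reached.\<close>

lemma mono_subseq_nat:
  fixes s :: "nat \<Rightarrow> nat"
  shows "\<exists>f :: nat \<Rightarrow> nat. strict_mono f \<and> mono (\<lambda>i. s (f i))"
proof -
  obtain f :: "nat \<Rightarrow> nat" where f: "strict_mono f" "monoseq (\<lambda>i. s (f i))"
    using seq_monosub by blast
  from f(2) consider "incseq (\<lambda>i. s (f i))" | "decseq (\<lambda>i. s (f i))"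
    by (auto simp: monoseq_iff)
  then show ?thesis
  proof cases
    case 2
    obtain N where N: "\<And>i. s (f N) \<le> s (f i)"
      using ex_has_least_nat[of "\<lambda>_. True" _ "\<lambda>i. s (f i)"] by auto
    have "s (f (N + i)) = s (f N)" for i
      using N[of "N + i"] decseqD[OF 2, of N "N + i"] by simp
    moreover have "strict_mono (\<lambda>i. f (N + i))"
      using f(1) by (simp add: strict_mono_def)
    ultimately show ?thesis
      by (intro exI[of _ "\<lambda>i. f (N + i)"]) (simp add: mono_def)
  qed (use f(1) in blast)
qed

lemma mono_subseq_finite:
  fixes a :: "nat \<Rightarrow> 'j \<Rightarrow> nat"
  assumes "finite J"
  shows "\<exists>f :: nat \<Rightarrow> nat. strict_mono f \<and> (\<forall>j\<in>J. mono (\<lambda>i. a (f i) j))"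
  using assms
proof induction
  case empty
  show ?case
    by (intro exI[of _ "\<lambda>i. i"]) (simp add: strict_mono_def)
next
  case (insert j J)
  then obtain f :: "nat \<Rightarrow> nat" where f: "strict_mono f" "\<And>k. k \<in> J \<Longrightarrow> mono (\<lambda>i. a (f i) k)"
    by blast
  obtain g :: "nat \<Rightarrow> nat" where g: "strict_mono g" "mono (\<lambda>i. a (f (g i)) j)"
    using mono_subseq_nat[of "\<lambda>i. a (f i) j"] by blast
  have "mono (\<lambda>i. a (f (g i)) k)" if "k \<in> J" for k
    using monoD[OF f(2)[OF that]] strict_mono_mono[OF g(1)] by (auto simp: mono_def)
  moreover have "strict_mono (\<lambda>i. f (g i))"
    using f(1) g(1) by (simp add: strict_mono_def)
  ultimately show ?case
    using g(2) by (intro exI[of _ "\<lambda>i. f (g i)"]) auto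
qed

text \<open>\<open>B\<close> consists of the elements minimal for divisibility. Descent on the total
  degree finds a minimal divisor; an infinite \<open>B\<close> would have a subsequence monotone in
  every coordinate, hence two distinct comparable elements.\<close>

lemma dickson:
  fixes M :: "('n::finite \<Rightarrow>\<^sub>0 nat) set"
  shows "\<exists>B\<subseteq>M. finite B \<and> (\<forall>m\<in>M. \<exists>b\<in>B. \<exists>d. m = b + d)"
proof -
  define B where "B = {m \<in> M. \<forall>b\<in>M. (\<exists>d. m = b + d) \<longrightarrow> b = m}"
  define deg where "deg m = (\<Sum>j\<in>UNIV. Poly_Mapping.lookup m j)" for m :: "'n \<Rightarrow>\<^sub>0 nat"
  have deg_add: "deg (a + b) = deg a + deg b" for a b
    by (simp add: deg_def lookup_add sum.distrib)
  have deg_0: "d = 0" if "deg d = 0" for d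
    using that by (intro poly_mapping_eqI) (simp add: deg_def)
  have "\<exists>b\<in>B. \<exists>d. m = b + d" if "m \<in> M" for m
    using that
  proof (induction "deg m" arbitrary: m rule: less_induct)
    case less
    show ?case
    proof (cases "m \<in> B")
      case False
      then obtain b d where b: "b \<in> M" "m = b + d" "b \<noteq> m"
        using less.prems by (auto simp: B_def)
      then have "deg b < deg m"
        using deg_0[of d] by (cases "deg d = 0") (auto simp: deg_add)
      then show ?thesis
        using less.hyps[OF _ b(1)] b(2) by (metis add.assoc)
    qed (metis add_0_right)
  qed
  moreover have "finite B"
  proof (rule ccontr)
    assume "infinite B"
    then obtain s :: "nat \<Rightarrow> 'n \<Rightarrow>\<^sub>0 nat" where s: "inj s" "range s \<subseteq> B"
      using infinite_countable_subset by blast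
    obtain f :: "nat \<Rightarrow> nat" where f: "strict_mono f" "\<And>j. mono (\<lambda>i. Poly_Mapping.lookup (s (f i)) j)"
      using mono_subseq_finite[of UNIV "\<lambda>i. Poly_Mapping.lookup (s i)"] by auto
    have "s (f 1) = s (f 0) + (s (f 1) - s (f 0))"
      using monoD[OF f(2), of 0 1] by (intro poly_mapping_eqI) (simp add: lookup_add lookup_minus)
    then have "s (f 0) = s (f 1)"
      using s(2) unfolding B_def by blast
    then show False
      using injD[OF s(1)] strict_mono_eq[OF f(1)] by fastforce
  qed
  ultimately show ?thesis
    by (intro exI[of _ B]) (auto simp: B_def)
qed

text \<open>
  A polynomial over the ring of all \<open>x\<^sub>i\<^sub>j\<close> is evaluated at the generic point
  \<open>(x\<^sub>w\<^sub>j)\<^sub>j\<close> of the \<open>w\<close>-th copy of affine space.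
\<close>

type_synonym ('n, 'k) block_poly = "('n, (nat \<times> 'n, 'k) mpoly) mpoly"

definition block_mon :: "nat \<Rightarrow> ('n \<Rightarrow>\<^sub>0 nat) \<Rightarrow> (nat \<times> 'n, 'k::comm_ring_1) mpoly" where
  "block_mon w = mon_val (\<lambda>j. mp_var (w, j))"

definition at_block :: "nat \<Rightarrow> ('n, 'k::comm_ring_1) block_poly \<Rightarrow> (nat \<times> 'n, 'k) mpoly" where
  "at_block w = mp_subst id (\<lambda>j. mp_var (w, j))"

lemma rhom_at_block: "rhom (at_block w)"
  unfolding at_block_def by (rule rhom_mp_subst[OF rhom_id])

lemma at_block_eq:
  assumes "finite Y" "Poly_Mapping.keys g \<subseteq> Y"
  shows "at_block w g = (\<Sum>m\<in>Y. Poly_Mapping.lookup g m * block_mon w m)"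
  unfolding at_block_def block_mon_def by (simp add: mp_subst_superset[OF _ assms])

lemma at_block_single [simp]: "at_block w (Poly_Mapping.single m c) = c * block_mon w m"
  by (simp add: at_block_def block_mon_def mp_subst_single)

lemma at_block_const [simp]: "at_block w (mp_const c) = c"
  by (simp add: at_block_def mp_subst_const)

lemma block_mon_add: "block_mon w (m + m') = block_mon w m * block_mon w m'"
  by (simp add: block_mon_def mon_val_add)

lemma perm_act_block_mon: "perm_act \<rho> (block_mon w m) = block_mon (\<rho> w) m"
  by (simp add: block_mon_def rhom_mon_val[OF rhom_perm_act])

lemma lookup_sum_single:
  assumes "finite Y"
  shows "Poly_Mapping.lookup (\<Sum>m\<in>Y. Poly_Mapping.single m (c m)) k = (if k \<in> Y then c k else 0)"
  using assms by (simp add: lookup_sum lookup_single when_def)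

lemma lookup_const_mult: "Poly_Mapping.lookup (mp_const u * C) m = u * Poly_Mapping.lookup C m"
  by (simp add: mp_const_def Poly_Mapping.map.rep_eq when_def flip: mult_map_scale_conv_mult)

text \<open>
  A Groebner basis, modulo the prime \<open>y\<close>, of the ideal of all polynomials that vanish modulo
  \<open>y\<close> on all but finitely many blocks; the last clause is the independence of the standard
  monomials.
\<close>

lemma exists_block_basis:
  fixes y :: "(nat \<times> 'n::finite, 'k::comm_ring_1) mpoly set" and r :: "('n \<Rightarrow>\<^sub>0 nat) \<Rightarrow> nat"
  assumes y: "y \<in> Spec" and r: "inj r"
  shows "\<exists>B (g :: ('n \<Rightarrow>\<^sub>0 nat) \<Rightarrow> ('n, 'k) block_poly). finite B
    \<and> (\<forall>b\<in>B. finite {w. at_block w (g b) \<notin> y} \<and> Poly_Mapping.lookup (g b) b \<notin> y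
        \<and> (\<forall>m\<in>Poly_Mapping.keys (g b). m \<noteq> b \<longrightarrow> r m < r b))
    \<and> (\<forall>f. finite {w. at_block w f \<notin> y} \<longrightarrow> (\<exists>m. Poly_Mapping.lookup f m \<notin> y) \<longrightarrow>
         (\<exists>b\<in>B. \<exists>d. Poly_Mapping.lookup f (b + d) \<notin> y))"
proof -
  \<comment> \<open>Leading monomials are taken modulo \<open>y\<close>: coefficients in
    \<open>y\<close> count as zero.\<close>
  define lead where "lead f m \<longleftrightarrow> finite {w. at_block w f \<notin> y} \<and> Poly_Mapping.lookup f m \<notin> y
    \<and> (\<forall>m'. Poly_Mapping.lookup f m' \<notin> y \<longrightarrow> r m' \<le> r m)" for f :: "('n, 'k) block_poly" and m
  define L where "L = {m. \<exists>f. lead f m}"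
  obtain B where B: "B \<subseteq> L" "finite B" and div: "\<And>m. m \<in> L \<Longrightarrow> \<exists>b\<in>B. \<exists>d. m = b + d"
    using dickson[of L] by blast
  define f where "f b = (SOME f. lead f b)" for b
  have f: "lead (f b) b" if "b \<in> B" for b
  proof -
    have "b \<in> L"
      using B(1) that by (rule subsetD)
    then show ?thesis
      unfolding f_def L_def mem_Collect_eq by (rule someI_ex)
  qed
  \<comment> \<open>Terms with coefficients in \<open>y\<close> are dropped from \<open>f b\<close>,
    so that \<open>b\<close> leads \<open>g b\<close> literally and not only modulo
    \<open>y\<close>.\<close>
  define Y where "Y b = {m \<in> Poly_Mapping.keys (f b). Poly_Mapping.lookup (f b) m \<notin> y}" for b
  define g where "g b = (\<Sum>m\<in>Y b. Poly_Mapping.single m (Poly_Mapping.lookup (f b) m))" for b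
  have finY: "finite (Y b)" for b
    by (simp add: Y_def)
  have Y_iff: "m \<in> Y b \<longleftrightarrow> Poly_Mapping.lookup (f b) m \<notin> y" for m b
    using Spec_zero[OF y] by (auto simp: Y_def in_keys_iff)
  have lookup_g: "Poly_Mapping.lookup (g b) m = (if m \<in> Y b then Poly_Mapping.lookup (f b) m else 0)" for b m
    unfolding g_def by (rule lookup_sum_single[OF finY])
  have diff: "at_block w (f b) - at_block w (g b) \<in> y" for w b
  proof -
    let ?K = "Poly_Mapping.keys (f b)"
    have "Poly_Mapping.keys (g b) \<subseteq> ?K"
      by (auto simp: in_keys_iff lookup_g split: if_splits)
    then have "at_block w (f b) - at_block w (g b) =
        (\<Sum>m\<in>?K. (Poly_Mapping.lookup (f b) m - Poly_Mapping.lookup (g b) m) * block_mon w m)"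
      by (simp add: at_block_eq[of ?K] left_diff_distrib sum_subtractf)
    also have "\<dots> \<in> y"
      by (intro Spec_sum[OF y] Spec_mult'[OF y]) (auto simp: lookup_g Y_iff Spec_zero[OF y])
    finally show ?thesis .
  qed
  have "finite {w. at_block w (g b) \<notin> y}" if "b \<in> B" for b
  proof (rule finite_subset)
    show "finite {w. at_block w (f b) \<notin> y}"
      using f[OF that] by (simp add: lead_def)
    have "at_block w (g b) \<in> y" if "at_block w (f b) \<in> y" for w
      using Spec_diff[OF y that diff[of w b]] by simp
    then show "{w. at_block w (g b) \<notin> y} \<subseteq> {w. at_block w (f b) \<notin> y}"
      by blast
  qed
  moreover have "Poly_Mapping.lookup (g b) b \<notin> y" if "b \<in> B" for b
    using f[OF that] by (auto simp: lead_def lookup_g Y_iff)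
  moreover have "r m < r b" if "b \<in> B" "m \<in> Poly_Mapping.keys (g b)" "m \<noteq> b" for b m
  proof -
    have "Poly_Mapping.lookup (f b) m \<notin> y"
      using that(2) Y_iff by (auto simp: in_keys_iff lookup_g split: if_splits)
    then have "r m \<le> r b"
      using f[OF that(1)] by (auto simp: lead_def)
    then show ?thesis
      using that(3) r by (metis injD le_neq_implies_less)
  qed
  \<comment> \<open>The leading monomial of \<open>h\<close> modulo \<open>y\<close> lies in
    \<open>L\<close> and is therefore divisible by some \<open>b \<in> B\<close>.\<close>
  moreover have "\<exists>b\<in>B. \<exists>d. Poly_Mapping.lookup h (b + d) \<notin> y"
    if fin: "finite {w. at_block w h \<notin> y}" and ex: "\<exists>m. Poly_Mapping.lookup h m \<notin> y" for h
  proof -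
    let ?T = "{m. Poly_Mapping.lookup h m \<notin> y}"
    have "?T \<subseteq> Poly_Mapping.keys h"
      using Spec_zero[OF y] by (auto simp: in_keys_iff)
    then have "finite ?T"
      by (rule finite_subset) simp
    then have "Max (r ` ?T) \<in> r ` ?T" and max: "\<And>m. m \<in> ?T \<Longrightarrow> r m \<le> Max (r ` ?T)"
      using ex by (intro Max_in Max_ge; auto)+
    then obtain m where m: "m \<in> ?T" "r m = Max (r ` ?T)"
      by auto
    then have "lead h m"
      using fin max by (auto simp: lead_def)
    then have "\<exists>b\<in>B. \<exists>d. m = b + d"
      by (intro div) (auto simp: L_def)
    then show ?thesis
      using m(1) by auto
  qed
  ultimately show ?thesis
    using B(2) by (intro exI[of _ B] exI[of _ g]) blast
qed

section \<open>Division with remainder at one block\<close>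

inductive_set gen_ideal :: "'a::comm_ring_1 set \<Rightarrow> 'a set" for G where
  zero: "0 \<in> gen_ideal G"
| add_mult: "x \<in> G \<Longrightarrow> a \<in> gen_ideal G \<Longrightarrow> c * x + a \<in> gen_ideal G"

lemma gen_ideal_add: "a \<in> gen_ideal G \<Longrightarrow> b \<in> gen_ideal G \<Longrightarrow> a + b \<in> gen_ideal G"
  by (induction rule: gen_ideal.induct) (auto simp: add.assoc intro: gen_ideal.intros)

lemma gen_ideal_mult: "a \<in> gen_ideal G \<Longrightarrow> c * a \<in> gen_ideal G"
proof (induction rule: gen_ideal.induct)
  case (add_mult x a d)
  then show ?case
    using gen_ideal.add_mult[of x G "c * a" "c * d"] by (simp add: algebra_simps)
qed (auto intro: gen_ideal.intros)

lemma gen_ideal_base: "x \<in> G \<Longrightarrow> c * x \<in> gen_ideal G"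
  using gen_ideal.add_mult[OF _ gen_ideal.zero, of x G c] by simp

inductive_set block_span :: "(nat \<times> 'n) set \<Rightarrow> nat \<Rightarrow> (nat \<times> 'n, 'k::comm_ring_1) mpoly set" for V w where
  zero: "0 \<in> block_span V w"
| add_mon: "c \<in> polys V \<Longrightarrow> f \<in> block_span V w \<Longrightarrow> c * block_mon w m + f \<in> block_span V w"

lemma block_span_mon: "c \<in> polys V \<Longrightarrow> c * block_mon w m \<in> block_span V w"
  using block_span.add_mon[OF _ block_span.zero, of c V w m] by simp

lemma block_span_add: "f \<in> block_span V w \<Longrightarrow> g \<in> block_span V w \<Longrightarrow> f + g \<in> block_span V w"
  by (induction rule: block_span.induct) (auto simp: add.assoc intro: block_span.intros)

lemma block_span_mult_mon:
  assumes "c \<in> polys V" "f \<in> block_span V w"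
  shows "(c * block_mon w m) * f \<in> block_span V w"
  using assms(2)
proof induction
  case (add_mon d f m')
  then show ?case
    using block_span.add_mon[OF polys.mult[OF assms(1) add_mon(1)] add_mon.IH, of "m + m'"]
    by (simp add: block_mon_add algebra_simps)
qed (simp add: block_span.zero)

lemma block_span_mult: "f \<in> block_span V w \<Longrightarrow> g \<in> block_span V w \<Longrightarrow> f * g \<in> block_span V w"
  by (induction rule: block_span.induct)
    (auto simp: distrib_right intro: block_span.zero block_span_add block_span_mult_mon)

text \<open>Variables in \<open>V\<close> are coefficients and the others are monomials of block
  \<open>w\<close>; products are covered by \<open>block_span_mult\<close>.\<close>

lemma polys_subset_block_span:
  assumes "f \<in> polys (V \<union> {w} \<times> UNIV)"
  shows "f \<in> block_span V w"
  using assms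
proof induction
  case (const c)
  show ?case
    using block_span_mon[OF polys.const[of c V], of w 0] by (simp add: block_mon_def)
next
  case (var v)
  show ?case
  proof (cases "v \<in> V")
    case True
    then show ?thesis
      using block_span_mon[OF polys.var[OF True], of w 0] by (simp add: block_mon_def)
  next
    case False
    then obtain j where "v = (w, j)"
      using var by auto
    then show ?thesis
      using block_span_mon[OF polys_one, of w "Poly_Mapping.single j 1" V] by (simp add: block_mon_def)
  qed
qed (auto intro: block_span_add block_span_mult)

lemma gen_ideal_subset_Spec:
  assumes "y \<in> Spec" "rhom \<phi>" "\<And>x. x \<in> G \<Longrightarrow> \<phi> x \<in> y" "f \<in> gen_ideal G"
  shows "\<phi> f \<in> y"
  using assms(4)
  by induction (simp_all add: rhom_simps[OF assms(2)] Spec_zero[OF assms(1)] Spec_add[OF assms(1)]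
      Spec_mult[OF assms(1)] assms(3))

lemma gen_ideal_kernel:
  assumes "rhom \<phi>" "\<And>x. x \<in> G \<Longrightarrow> \<phi> x = 0" "f \<in> gen_ideal G"
  shows "\<phi> f = 0"
  using assms(3) by induction (simp_all add: rhom_simps[OF assms(1)] assms(2))

text \<open>
  Division with remainder at block \<open>w\<close> by the basis \<open>g\<close>, up to factors that do not vanish at
  the point \<open>\<nu>\<close>.
\<close>

definition reducible ::
  "(nat \<times> 'n \<Rightarrow> 'k::comm_ring_1) \<Rightarrow> (nat \<times> 'n) set \<Rightarrow> (nat \<times> 'n) set \<Rightarrow> nat \<Rightarrow> ('n \<Rightarrow>\<^sub>0 nat) set \<Rightarrow>
   (('n \<Rightarrow>\<^sub>0 nat) \<Rightarrow> ('n, 'k) block_poly) \<Rightarrow> (nat \<times> 'n, 'k) mpoly \<Rightarrow> bool" where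
  "reducible \<nu> V0 V w B g F \<longleftrightarrow> (\<exists>u C. u \<in> polys V0 \<and> mp_eval \<nu> u \<noteq> 0 \<and>
     (\<forall>m. Poly_Mapping.lookup C m \<in> polys V) \<and>
     (\<forall>m\<in>Poly_Mapping.keys C. \<forall>b\<in>B. \<forall>d. m \<noteq> b + d) \<and>
     u * F - at_block w C \<in> gen_ideal ((\<lambda>b. at_block w (g b)) ` B))"

context
  fixes \<nu> :: "nat \<times> 'n \<Rightarrow> 'k::idom" and V0 V :: "(nat \<times> 'n) set" and w :: nat
    and B :: "('n \<Rightarrow>\<^sub>0 nat) set" and g :: "('n \<Rightarrow>\<^sub>0 nat) \<Rightarrow> ('n, 'k) block_poly"
  assumes V0: "V0 \<subseteq> V"
begin

private abbreviation "red \<equiv> reducible \<nu> V0 V w B g"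
private abbreviation "rels \<equiv> gen_ideal ((\<lambda>b. at_block w (g b)) ` B)"

lemma reducible_zero: "red 0"
  unfolding reducible_def
  by (intro exI[of _ 1] exI[of _ 0]) (simp add: rhom_simps[OF rhom_at_block] gen_ideal.zero)

text \<open>Each identity is multiplied by the factor of the other. The product of the factors is
  nonzero at \<nu> because \<open>'k\<close> is a domain, and no new monomials enter the
  remainder.\<close>

lemma reducible_add:
  assumes "red F" "red F'"
  shows "red (F + F')"
proof -
  obtain u C where 1: "u \<in> polys V0" "mp_eval \<nu> u \<noteq> 0" "\<And>m. Poly_Mapping.lookup C m \<in> polys V"
    "\<And>m b d. m \<in> Poly_Mapping.keys C \<Longrightarrow> b \<in> B \<Longrightarrow> m \<noteq> b + d" "u * F - at_block w C \<in> rels"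
    using assms(1) unfolding reducible_def by blast
  obtain u' C' where 2: "u' \<in> polys V0" "mp_eval \<nu> u' \<noteq> 0" "\<And>m. Poly_Mapping.lookup C' m \<in> polys V"
    "\<And>m b d. m \<in> Poly_Mapping.keys C' \<Longrightarrow> b \<in> B \<Longrightarrow> m \<noteq> b + d" "u' * F' - at_block w C' \<in> rels"
    using assms(2) unfolding reducible_def by blast
  let ?D = "mp_const u' * C + mp_const u * C'"
  have lookup: "Poly_Mapping.lookup ?D m = u' * Poly_Mapping.lookup C m + u * Poly_Mapping.lookup C' m" for m
    by (simp add: lookup_add lookup_const_mult)
  have "u * u' * (F + F') - at_block w ?D =
      u' * (u * F - at_block w C) + u * (u' * F' - at_block w C')"
    by (simp add: rhom_simps[OF rhom_at_block] algebra_simps)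
  also have "\<dots> \<in> rels"
    by (intro gen_ideal_add gen_ideal_mult 1 2)
  finally have "u * u' * (F + F') - at_block w ?D \<in> rels" .
  moreover have "Poly_Mapping.lookup ?D m \<in> polys V" for m
    unfolding lookup by (intro polys.intros polys_mono[OF V0] 1 2)
  moreover have "m \<noteq> b + d" if "m \<in> Poly_Mapping.keys ?D" "b \<in> B" for m b d
  proof -
    have "m \<in> Poly_Mapping.keys C \<or> m \<in> Poly_Mapping.keys C'"
      using that(1) by (auto simp: in_keys_iff lookup)
    then show ?thesis
      using 1(4) 2(4) that(2) by blast
  qed
  ultimately show ?thesis
    unfolding reducible_def using 1(1,2) 2(1,2)
    by (intro exI[of _ "u * u'"] exI[of _ ?D]) (simp add: polys.mult)
qed

lemma reducible_mult:
  assumes "red F" "c \<in> polys V"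
  shows "red (c * F)"
proof -
  obtain u C where 1: "u \<in> polys V0" "mp_eval \<nu> u \<noteq> 0" "\<And>m. Poly_Mapping.lookup C m \<in> polys V"
    "\<And>m b d. m \<in> Poly_Mapping.keys C \<Longrightarrow> b \<in> B \<Longrightarrow> m \<noteq> b + d" "u * F - at_block w C \<in> rels"
    using assms(1) unfolding reducible_def by blast
  have "u * (c * F) - at_block w (mp_const c * C) = c * (u * F - at_block w C)"
    by (simp add: rhom_simps[OF rhom_at_block] algebra_simps)
  then have "u * (c * F) - at_block w (mp_const c * C) \<in> rels"
    using gen_ideal_mult[OF 1(5)] by simp
  moreover have "m \<noteq> b + d" if "m \<in> Poly_Mapping.keys (mp_const c * C)" "b \<in> B" for m b d
  proof -
    have "m \<in> Poly_Mapping.keys C"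
      using that(1) by (auto simp: in_keys_iff lookup_const_mult)
    then show ?thesis
      using 1(4) that(2) by blast
  qed
  ultimately show ?thesis
    unfolding reducible_def using 1(1-4) assms(2)
    by (intro exI[of _ u] exI[of _ "mp_const c * C"]) (simp add: lookup_const_mult polys.mult)
qed

lemma reducible_sum: "(\<And>i. i \<in> Y \<Longrightarrow> red (f i)) \<Longrightarrow> red (sum f Y)"
  by (induction Y rule: infinite_finite_induct) (auto intro: reducible_zero reducible_add)

text \<open>Instead of dividing by \<open>l\<close>, it is absorbed into the factor
  \<open>u\<close>.\<close>

lemma reducible_cancel:
  assumes "red F'" "l * F - F' \<in> rels" "l \<in> polys V0" "mp_eval \<nu> l \<noteq> 0"
  shows "red F"
proof -
  obtain u C where 1: "u \<in> polys V0" "mp_eval \<nu> u \<noteq> 0" "\<And>m. Poly_Mapping.lookup C m \<in> polys V"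
    "\<And>m b d. m \<in> Poly_Mapping.keys C \<Longrightarrow> b \<in> B \<Longrightarrow> m \<noteq> b + d" "u * F' - at_block w C \<in> rels"
    using assms(1) unfolding reducible_def by blast
  have "u * l * F - at_block w C = u * (l * F - F') + (u * F' - at_block w C)"
    by (simp add: algebra_simps)
  also have "\<dots> \<in> rels"
    by (intro gen_ideal_add gen_ideal_mult 1 assms)
  finally show ?thesis
    unfolding reducible_def using 1(1-4) assms(3,4)
    by (intro exI[of _ "u * l"] exI[of _ C]) (simp add: polys.mult)
qed

text \<open>Induction on the rank: if \<open>m = b + d\<close>, the relation \<open>g b\<close>
  shifted by \<open>d\<close> trades the monomial for monomials \<open>k + d\<close> with
  \<open>k\<close> below \<open>b\<close>, which have smaller rank.\<close>

lemma reducible_block_mon: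
  fixes r :: "('n \<Rightarrow>\<^sub>0 nat) \<Rightarrow> nat"
  assumes r: "\<And>a b c. r a < r b \<Longrightarrow> r (a + c) < r (b + c)"
    and coeffs: "\<And>b m. b \<in> B \<Longrightarrow> Poly_Mapping.lookup (g b) m \<in> polys V0"
    and lead: "\<And>b m. b \<in> B \<Longrightarrow> m \<in> Poly_Mapping.keys (g b) \<Longrightarrow> m \<noteq> b \<Longrightarrow> r m < r b"
    and unit: "\<And>b. b \<in> B \<Longrightarrow> mp_eval \<nu> (Poly_Mapping.lookup (g b) b) \<noteq> 0"
  shows "red (block_mon w m)"
proof (induction "r m" arbitrary: m rule: less_induct)
  case less
  show ?case
  proof (cases "\<exists>b\<in>B. \<exists>d. m = b + d")
    case False
    then show ?thesis
      unfolding reducible_def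
      by (intro exI[of _ 1] exI[of _ "Poly_Mapping.single m 1"])
        (auto simp: lookup_single when_def gen_ideal.zero)
  next
    case True
    then obtain b d where b: "b \<in> B" and m: "m = b + d"
      by blast
    let ?K = "Poly_Mapping.keys (g b) - {b}"
    let ?l = "Poly_Mapping.lookup (g b) b"
    define F' where "F' = (\<Sum>k\<in>?K. - Poly_Mapping.lookup (g b) k * block_mon w (k + d))"
    have "at_block w (g b) = (\<Sum>k\<in>insert b ?K. Poly_Mapping.lookup (g b) k * block_mon w k)"
      by (rule at_block_eq) auto
    also have "\<dots> = ?l * block_mon w b + (\<Sum>k\<in>?K. Poly_Mapping.lookup (g b) k * block_mon w k)"
      by (subst sum.insert) auto
    finally have "?l * block_mon w m - F' = block_mon w d * at_block w (g b)"
      by (simp add: m F'_def block_mon_add algebra_simps sum_distrib_left sum_negf)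
    then have "?l * block_mon w m - F' \<in> rels"
      using b by (auto intro: gen_ideal_base)
    moreover have "red F'"
      unfolding F'_def
    proof (intro reducible_sum reducible_mult)
      fix k assume "k \<in> ?K"
      then have "r k < r b"
        using lead[OF b] by auto
      then show "red (block_mon w (k + d))"
        using less r by (simp add: m)
      show "- Poly_Mapping.lookup (g b) k \<in> polys V"
        by (intro polys_uminus polys_mono[OF V0] coeffs b)
    qed
    ultimately show ?thesis
      using reducible_cancel coeffs[OF b] unit[OF b] by blast
  qed
qed

lemma reducible_block_span:
  assumes "\<And>m. red (block_mon w m)" "F \<in> block_span V w"
  shows "red F"
  using assms(2) by induction (auto intro: reducible_zero reducible_add reducible_mult assms(1))

end

lemma perm_act_at_block:
  assumes "\<And>m. perm_act \<rho> (Poly_Mapping.lookup g m) = Poly_Mapping.lookup g m"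
  shows "perm_act \<rho> (at_block w g) = at_block (\<rho> w) g"
  by (simp add: at_block_eq[OF finite_keys subset_refl] rhom_sum[OF rhom_perm_act]
      rhom_mult[OF rhom_perm_act] assms perm_act_block_mon)

text \<open>
  Vanishing modulo \<open>y\<close> on all injective choices of non-exceptional blocks passes to \<open>K\<close>-points:
  after division by the basis at one block, the remainder is supported on standard
  monomials, which are independent as functions on the non-exceptional blocks.
\<close>

lemma specialization:
  fixes y :: "(nat \<times> 'n::finite, 'k::idom) mpoly set" and r :: "('n \<Rightarrow>\<^sub>0 nat) \<Rightarrow> nat"
  assumes y: "y \<in> Spec" and finE: "finite E"
    and V0: "V0 = {..<N0} \<times> (UNIV :: 'n set)"
    and r: "\<And>a b c. r a < r b \<Longrightarrow> r (a + c) < r (b + c)"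
    and coeffs: "\<And>b m. b \<in> B \<Longrightarrow> Poly_Mapping.lookup (g b) m \<in> polys V0"
    and lead: "\<And>b m. b \<in> B \<Longrightarrow> m \<in> Poly_Mapping.keys (g b) \<Longrightarrow> m \<noteq> b \<Longrightarrow> r m < r b"
    and vanish: "\<And>b w. b \<in> B \<Longrightarrow> w \<notin> E \<Longrightarrow> at_block w (g b) \<in> y"
    and indep: "\<And>f. finite {w. at_block w f \<notin> y} \<Longrightarrow> \<exists>m. Poly_Mapping.lookup f m \<notin> y \<Longrightarrow>
         \<exists>b\<in>B. \<exists>d. Poly_Mapping.lookup f (b + d) \<notin> y"
    and unit: "\<And>b. b \<in> B \<Longrightarrow> mp_eval \<nu> (Poly_Mapping.lookup (g b) b) \<noteq> 0"
    and \<nu>0: "\<And>f. f \<in> y \<Longrightarrow> f \<in> polys V0 \<Longrightarrow> mp_eval \<nu> f = 0"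
    and "finite W"
    and "W \<inter> {..<N0} = {}"
    and "\<And>w b. w \<in> W \<Longrightarrow> b \<in> B \<Longrightarrow> mp_eval \<nu> (at_block w (g b)) = 0"
    and "F \<in> polys (({..<N0} \<union> W) \<times> UNIV)"
    and "\<And>\<rho>. (\<And>i. i < N0 \<Longrightarrow> \<rho> i = i) \<Longrightarrow> inj_on \<rho> W \<Longrightarrow> \<rho> ` W \<inter> E = {} \<Longrightarrow> perm_act \<rho> F \<in> y"
  shows "mp_eval \<nu> F = 0"
  using assms(11-)
proof (induction W arbitrary: F rule: finite_induct)
  case empty
  have "F \<in> y"
    using empty.prems(4)[of id] by (simp only: perm_act_id) simp
  then show ?case
    using empty.prems(3) by (intro \<nu>0) (simp_all add: V0)
next
  \<comment> \<open>Block \<open>w\<close> is eliminated: \<open>F\<close> is expanded in its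
    monomials, with coefficients from the other blocks, and divided by the basis.\<close>
  case (insert w W)
  define V where "V = ({..<N0} \<union> W) \<times> (UNIV :: 'n set)"
  have V0V: "V0 \<subseteq> V"
    by (auto simp: V0 V_def)
  have "F \<in> polys (V \<union> {w} \<times> UNIV)"
    using insert.prems(3) by (rule polys_mono[rotated]) (auto simp: V_def)
  then have span: "F \<in> block_span V w"
    by (rule polys_subset_block_span)
  have "reducible \<nu> V0 V w B g (block_mon w m)" for m
    by (rule reducible_block_mon[where r = r, OF V0V]) (fact r coeffs lead unit)+
  then have "reducible \<nu> V0 V w B g F"
    by (rule reducible_block_span[OF V0V _ span])
  then obtain u C where u: "u \<in> polys V0" "mp_eval \<nu> u \<noteq> 0"
    and C: "\<And>m. Poly_Mapping.lookup C m \<in> polys V"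
    and std: "\<And>m b d. m \<in> Poly_Mapping.keys C \<Longrightarrow> b \<in> B \<Longrightarrow> m \<noteq> b + d"
    and id: "u * F - at_block w C \<in> gen_ideal ((\<lambda>b. at_block w (g b)) ` B)"
    unfolding reducible_def by blast
  have C0: "mp_eval \<nu> (Poly_Mapping.lookup C m) = 0" for m
  proof (rule insert.IH)
    show "W \<inter> {..<N0} = {}" "Poly_Mapping.lookup C m \<in> polys (({..<N0} \<union> W) \<times> UNIV)"
      using insert.prems(1) C by (auto simp: V_def)
    show "mp_eval \<nu> (at_block w (g b)) = 0" if "w \<in> W" "b \<in> B" for w b
      using insert.prems(2) that by simp
    fix \<rho> assume \<rho>: "\<And>i. i < N0 \<Longrightarrow> \<rho> i = i" "inj_on \<rho> W" "\<rho> ` W \<inter> E = {}"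
    \<comment> \<open>\<open>f\<close> is the remainder with coefficients moved by \<rho>. It
      vanishes modulo \<open>y\<close> at all but finitely many blocks and involves only standard
      monomials, so \<open>indep\<close> forces its coefficients into \<open>y\<close>.\<close>
    define f where "f = (\<Sum>m\<in>Poly_Mapping.keys C. Poly_Mapping.single m (perm_act \<rho> (Poly_Mapping.lookup C m)))"
    have lookup_f: "Poly_Mapping.lookup f m = perm_act \<rho> (Poly_Mapping.lookup C m)" for m
      by (auto simp: f_def lookup_sum_single in_keys_iff rhom_simps[OF rhom_perm_act])
    have "at_block a f \<in> y" if a: "a \<notin> E \<union> \<rho> ` W" for a
    proof -
      \<comment> \<open>\<open>\<rho>'\<close> also sends the eliminated block to \<open>a\<close>.
        It fixes the coefficients of the basis and thus carries the division identity to block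
        \<open>a\<close>.\<close>
      define \<rho>' where "\<rho>' = \<rho>(w := a)"
      have \<rho>'0: "\<rho>' i = i" if "i < N0" for i
        using that insert.prems(1) \<rho>(1) by (auto simp: \<rho>'_def)
      have \<rho>'V: "perm_act \<rho>' h = perm_act \<rho> h" if "h \<in> polys V" for h
        using that unfolding V_def
        by (rule perm_act_cong_polys) (use insert.hyps(2) insert.prems(1) in \<open>auto simp: \<rho>'_def\<close>)
      have fixed: "perm_act \<rho>' h = h" if "h \<in> polys V0" for h
        using perm_act_cong_polys[of h "{..<N0}" \<rho>' id] that \<rho>'0 by (simp add: V0 perm_act_id)
      have "perm_act \<rho>' (at_block w (g b)) = at_block (\<rho>' w) (g b)" if "b \<in> B" for b
        by (intro perm_act_at_block fixed coeffs that)
      then have "perm_act \<rho>' (at_block w (g b)) = at_block a (g b)" if "b \<in> B" for b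
        using that by (simp add: \<rho>'_def)
      then have "perm_act \<rho>' (u * F - at_block w C) \<in> y"
        using vanish a by (intro gen_ideal_subset_Spec[OF y rhom_perm_act _ id]) auto
      moreover have "perm_act \<rho>' F \<in> y"
      proof (rule insert.prems(4))
        have "\<rho>' ` W = \<rho> ` W"
          using insert.hyps(2) by (auto simp: \<rho>'_def)
        then show "inj_on \<rho>' (insert w W)" "\<rho>' ` insert w W \<inter> E = {}"
          using insert.hyps(2) \<rho>(2,3) a by (auto simp: \<rho>'_def inj_on_def)
      qed (rule \<rho>'0)
      ultimately have "perm_act \<rho>' (at_block w C) \<in> y"
        using Spec_diff[OF y Spec_mult[OF y, of "perm_act \<rho>' F" "perm_act \<rho>' u"]]
        by (fastforce simp: rhom_simps[OF rhom_perm_act])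
      also have "perm_act \<rho>' (at_block w C) = (\<Sum>m\<in>Poly_Mapping.keys C. Poly_Mapping.lookup f m * block_mon a m)"
        by (simp add: at_block_eq[OF finite_keys subset_refl] rhom_sum[OF rhom_perm_act]
            rhom_mult[OF rhom_perm_act] perm_act_block_mon lookup_f \<rho>'V C) (simp add: \<rho>'_def)
      also have "\<dots> = at_block a f"
        by (rule at_block_eq[symmetric]) (auto simp: in_keys_iff lookup_f rhom_simps[OF rhom_perm_act])
      finally show ?thesis .
    qed
    then have "{a. at_block a f \<notin> y} \<subseteq> E \<union> \<rho> ` W"
      by blast
    then have "finite {a. at_block a f \<notin> y}"
      by (rule finite_subset) (simp add: finE insert.hyps(1))
    moreover have "Poly_Mapping.lookup f (b + d) \<in> y" if "b \<in> B" for b d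
    proof -
      have "Poly_Mapping.lookup C (b + d) = 0"
        using std[of "b + d" b d] that by (auto simp: in_keys_iff)
      then show ?thesis
        by (simp add: lookup_f rhom_simps[OF rhom_perm_act] Spec_zero[OF y])
    qed
    ultimately show "perm_act \<rho> (Poly_Mapping.lookup C m) \<in> y"
      using indep lookup_f by metis
  qed
  \<comment> \<open>At \<nu> both the relations and the remainder vanish, while \<open>u\<close>
    does not.\<close>
  have "mp_eval \<nu> (u * F - at_block w C) = 0"
    using insert.prems(2) by (intro gen_ideal_kernel[OF rhom_mp_eval _ id]) auto
  moreover have "mp_eval \<nu> (at_block w C) = 0"
    by (simp add: at_block_eq[OF finite_keys subset_refl] rhom_sum[OF rhom_mp_eval] C0)
  ultimately show ?case
    using u(2) by simp
qed

section \<open>Coordinate rings\<close>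

text \<open>Ring laws pass along a surjection compatible with the operations. This serves both the
  quotient and the polynomial ring over it.\<close>

lemma cring_of_surj:
  fixes R (structure) and h :: "'a::comm_ring_1 \<Rightarrow> 'b"
  assumes carrier: "carrier R = range h"
    and add: "\<And>a b. h a \<oplus> h b = h (a + b)" and mult: "\<And>a b. h a \<otimes> h b = h (a * b)"
    and zero: "\<zero> = h 0" and one: "\<one> = h 1"
  shows "cring R"
proof (rule cringI)
  show "abelian_group R"
  proof (rule abelian_groupI)
    fix x assume "x \<in> carrier R"
    then obtain a where "x = h a"
      by (auto simp: carrier)
    then show "\<exists>y\<in>carrier R. y \<oplus> x = \<zero>"
      by (intro bexI[of _ "h (- a)"]) (simp_all add: carrier add zero)
  qed (auto simp: carrier add zero add_ac)
  show "comm_monoid R"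
    by (rule comm_monoidI) (auto simp: carrier mult one mult_ac)
qed (auto simp: carrier add mult algebra_simps)

definition quot_class :: "'a::comm_ring_1 set \<Rightarrow> 'a \<Rightarrow> 'a set" where
  "quot_class P F = {G. G - F \<in> P}"

definition quot_rep :: "'a set \<Rightarrow> 'a" where
  "quot_rep a = (SOME F. F \<in> a)"

text \<open>Operations use chosen representatives; for prime \<open>P\<close> the choice is
  immaterial by \<open>quot_rep_class\<close>. Classes are sets of polynomials, as
  \<open>coord_ring\<close> demands.\<close>

definition quot_algebra :: "(nat, 'k::field) mpoly set \<Rightarrow> 'k coord_ring" where
  "quot_algebra P =
     \<lparr>carrier = range (quot_class P),
      monoid.mult = (\<lambda>a b. quot_class P (quot_rep a * quot_rep b)),
      one = quot_class P 1,
      zero = quot_class P 0,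
      add = (\<lambda>a b. quot_class P (quot_rep a + quot_rep b)),
      module.smult = (\<lambda>c a. quot_class P (mp_const c * quot_rep a))\<rparr>"

lemma quot_class_eq_iff:
  assumes "P \<in> Spec"
  shows "quot_class P F = quot_class P G \<longleftrightarrow> F - G \<in> P"
proof
  assume "quot_class P F = quot_class P G"
  then have "F \<in> quot_class P G"
    using Spec_zero[OF assms] by (auto simp: quot_class_def)
  then show "F - G \<in> P"
    by (simp add: quot_class_def)
next
  assume *: "F - G \<in> P"
  have "H - F \<in> P \<longleftrightarrow> H - G \<in> P" for H
  proof
    assume "H - F \<in> P"
    from Spec_add[OF assms this *] show "H - G \<in> P" by simp
  next
    assume "H - G \<in> P"
    from Spec_diff[OF assms this *] show "H - F \<in> P" by simp
  qed
  then show "quot_class P F = quot_class P G"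
    by (simp add: quot_class_def)
qed

lemma quot_rep_class: "P \<in> Spec \<Longrightarrow> quot_rep (quot_class P F) - F \<in> P"
  unfolding quot_rep_def quot_class_def mem_Collect_eq
  by (rule someI[of _ F]) (simp add: Spec_zero)

context
  fixes P :: "(nat, 'k::field) mpoly set"
  assumes P: "P \<in> Spec"
begin

private abbreviation (input) "A \<equiv> quot_algebra P"
private abbreviation (input) "cl \<equiv> quot_class P"

lemma quot_carrier: "carrier A = range cl"
  and quot_zero: "\<zero>\<^bsub>A\<^esub> = cl 0"
  and quot_one: "\<one>\<^bsub>A\<^esub> = cl 1"
  by (simp_all add: quot_algebra_def)

lemma quot_mult: "cl F \<otimes>\<^bsub>A\<^esub> cl G = cl (F * G)"
proof -
  let ?f = "quot_rep (cl F)" and ?g = "quot_rep (cl G)"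
  have "?f * ?g - F * G = ?g * (?f - F) + F * (?g - G)"
    by (simp add: algebra_simps)
  also have "\<dots> \<in> P"
    by (intro Spec_add[OF P] Spec_mult[OF P] quot_rep_class[OF P])
  finally show ?thesis
    by (simp add: quot_algebra_def quot_class_eq_iff[OF P])
qed

lemma quot_add: "cl F \<oplus>\<^bsub>A\<^esub> cl G = cl (F + G)"
  using Spec_add[OF P quot_rep_class[OF P, of F] quot_rep_class[OF P, of G]]
  by (simp add: quot_algebra_def quot_class_eq_iff[OF P] algebra_simps)

lemma quot_smult: "c \<odot>\<^bsub>A\<^esub> cl F = cl (mp_const c * F)"
  using Spec_mult[OF P quot_rep_class[OF P, of F], of "mp_const c"]
  by (simp add: quot_algebra_def quot_class_eq_iff[OF P] algebra_simps)

lemma quot_cring: "cring A"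
  by (rule cring_of_surj[of _ cl]) (simp_all add: quot_carrier quot_add quot_mult quot_zero quot_one)

lemma quot_domain: "domain A"
proof (rule domain.intro[OF quot_cring], rule domain_axioms.intro)
  show "\<one>\<^bsub>A\<^esub> \<noteq> \<zero>\<^bsub>A\<^esub>"
    using Spec_one[OF P] by (simp add: quot_one quot_zero quot_class_eq_iff[OF P])
  fix a b assume ab: "a \<otimes>\<^bsub>A\<^esub> b = \<zero>\<^bsub>A\<^esub>" "a \<in> carrier A" "b \<in> carrier A"
  then obtain F G where FG: "a = cl F" "b = cl G"
    by (auto simp: quot_carrier)
  then have "F * G \<in> P"
    using ab(1) by (simp add: quot_mult quot_zero quot_class_eq_iff[OF P])
  then show "a = \<zero>\<^bsub>A\<^esub> \<or> b = \<zero>\<^bsub>A\<^esub>"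
    by (simp add: FG quot_zero quot_class_eq_iff[OF P] Spec_prime[OF P])
qed

lemma quot_is_algebra: "algebra (ring_of_type_algebra :: 'k ring) A"
proof (rule algebraI[OF cring_from_type_algebra quot_cring])
  fix a b :: 'k and x y assume xy: "x \<in> carrier A" "y \<in> carrier A"
  then obtain F G where FG: "x = cl F" "y = cl G"
    by (auto simp: quot_carrier)
  note simps = ring_of_type_algebra_def quot_carrier quot_smult quot_add quot_mult FG
    rhom_simps[OF rhom_mp_const]
  show "a \<odot>\<^bsub>A\<^esub> x \<in> carrier A" "a \<odot>\<^bsub>A\<^esub> (x \<oplus>\<^bsub>A\<^esub> y) = a \<odot>\<^bsub>A\<^esub> x \<oplus>\<^bsub>A\<^esub> a \<odot>\<^bsub>A\<^esub> y"
    "(a \<oplus>\<^bsub>ring_of_type_algebra\<^esub> b) \<odot>\<^bsub>A\<^esub> x = a \<odot>\<^bsub>A\<^esub> x \<oplus>\<^bsub>A\<^esub> b \<odot>\<^bsub>A\<^esub> x"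
    "(a \<otimes>\<^bsub>ring_of_type_algebra\<^esub> b) \<odot>\<^bsub>A\<^esub> x = a \<odot>\<^bsub>A\<^esub> (b \<odot>\<^bsub>A\<^esub> x)"
    "\<one>\<^bsub>ring_of_type_algebra\<^esub> \<odot>\<^bsub>A\<^esub> x = x" "(a \<odot>\<^bsub>A\<^esub> x) \<otimes>\<^bsub>A\<^esub> y = a \<odot>\<^bsub>A\<^esub> (x \<otimes>\<^bsub>A\<^esub> y)"
    by (simp_all add: simps distrib_left distrib_right mult.assoc)
qed

text \<open>There are infinitely many variables, but those outside \<open>D\<close> are zero in the
  quotient, so the others generate it over the constants.\<close>

lemma quot_affine_integral_finite_type:
  assumes D: "finite D" "\<And>i. i \<notin> D \<Longrightarrow> mp_var i \<in> P"
  shows "affine_integral_finite_type A"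
proof -
  interpret cring A
    by (rule quot_cring)
  let ?F = "(\<lambda>i. cl (mp_var i)) ` D"
  let ?H = "range (\<lambda>c. c \<odot>\<^bsub>A\<^esub> \<one>\<^bsub>A\<^esub>) \<union> ?F"
  have H: "?H \<subseteq> carrier A"
    by (auto simp: quot_carrier quot_one quot_smult)
  have const: "cl (mp_const c) \<in> generate_ring A ?H" for c
    by (rule generate_ring.incl) (auto simp: quot_one quot_smult)
  have "cl F \<in> generate_ring A ?H" for F
  proof (induction F rule: mpoly_induct)
    case (var i)
    show ?case
    proof (cases "i \<in> D")
      case False
      then have "cl (mp_var i) = cl (mp_const 0)"
        using D(2) by (simp add: quot_class_eq_iff[OF P] rhom_simps[OF rhom_mp_const])
      then show ?thesis
        using const by simp
    qed (auto intro: generate_ring.incl)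
  next
    case (add f g)
    then show ?case
      using generate_ring.eng_add[OF add] by (simp add: quot_add)
  next
    case (mult f g)
    then show ?case
      using generate_ring.eng_mult[OF mult] by (simp add: quot_mult)
  qed (rule const)
  then have "carrier A = generate_ring A ?H"
    using generate_ring_incl[OF H] by (auto simp: quot_carrier)
  then show ?thesis
    unfolding affine_integral_finite_type_def using quot_is_algebra quot_domain D(1)
    by (intro conjI exI[of _ ?F]) (auto simp: quot_carrier)
qed

section \<open>Rational points of the quotient\<close>

definition quot_point :: "((nat, 'k) mpoly set \<Rightarrow> 'k) \<Rightarrow> nat \<Rightarrow> 'k" where
  "quot_point x i = x (cl (mp_var i))"

text \<open>A homomorphism of \<open>K\<close>-algebras is determined by its values on the
  variables.\<close>

lemma K_points_eval:
  assumes "x \<in> K_points A"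
  shows "x (cl F) = mp_eval (quot_point x) F"
proof (induction F rule: mpoly_induct)
  case (const c)
  have "x (c \<odot>\<^bsub>A\<^esub> \<one>\<^bsub>A\<^esub>) = c"
    using assms by (simp add: K_points_def)
  then show ?case
    by (simp add: quot_one quot_smult)
next
  case (add f g)
  have "x (cl f \<oplus>\<^bsub>A\<^esub> cl g) = x (cl f) + x (cl g)"
    using assms by (auto simp: K_points_def ring_hom_def quot_carrier ring_of_type_algebra_def)
  then show ?case
    by (simp add: quot_add add)
next
  case (mult f g)
  have "x (cl f \<otimes>\<^bsub>A\<^esub> cl g) = x (cl f) * x (cl g)"
    using assms by (auto simp: K_points_def ring_hom_def quot_carrier ring_of_type_algebra_def)
  then show ?case
    by (simp add: quot_mult mult)
qed (simp add: quot_point_def)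

lemma K_points_vanish:
  assumes "x \<in> K_points A" "F \<in> P"
  shows "mp_eval (quot_point x) F = 0"
proof -
  have "cl F = cl 0"
    using assms(2) by (simp add: quot_class_eq_iff[OF P])
  then have "mp_eval (quot_point x) F = mp_eval (quot_point x) 0"
    using K_points_eval[OF assms(1)] by metis
  then show ?thesis
    by (simp add: rhom_zero[OF rhom_mp_eval])
qed

text \<open>Evaluation at \<zeta> kills \<open>P\<close> and so factors through the
  quotient.\<close>

lemma exists_K_point:
  assumes "\<And>F. F \<in> P \<Longrightarrow> mp_eval \<zeta> F = 0"
  shows "\<exists>x\<in>K_points A. quot_point x = \<zeta>"
proof -
  define x where "x a = mp_eval \<zeta> (quot_rep a)" for a
  have x: "x (cl F) = mp_eval \<zeta> F" for F
    using assms[OF quot_rep_class[OF P, of F]] by (simp add: x_def)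
  have "x \<in> K_points A"
    unfolding K_points_def ring_hom_def
    by (auto simp: quot_carrier quot_add quot_mult quot_one quot_smult x ring_of_type_algebra_def)
  moreover have "quot_point x = \<zeta>"
    by (simp add: quot_point_def fun_eq_iff x)
  ultimately show ?thesis
    by blast
qed

section \<open>Polynomials over the quotient and closed subschemes\<close>

definition quot_poly :: "('n, (nat, 'k) mpoly) mpoly \<Rightarrow> ('n \<Rightarrow>\<^sub>0 nat) \<Rightarrow> (nat, 'k) mpoly set" where
  "quot_poly F m = cl (Poly_Mapping.lookup F m)"

lemma lookup_mult_splittings:
  fixes F G :: "('v, 'c::comm_ring_1) mpoly"
  shows "Poly_Mapping.lookup (F * G) m =
    (\<Sum>(a, b)\<in>{(a, b). a + b = m}. Poly_Mapping.lookup F a * Poly_Mapping.lookup G b)"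
proof (induction F rule: poly_mapping_add_induct)
  case (single a c)
  show ?case
  proof (induction G rule: poly_mapping_add_induct)
    case (single b d)
    have "(\<Sum>(a', b')\<in>{(a, b). a + b = m}. Poly_Mapping.lookup (Poly_Mapping.single a c) a' *
        Poly_Mapping.lookup (Poly_Mapping.single b d) b') =
      (\<Sum>p\<in>{(a, b). a + b = m}. if p = (a, b) then c * d else 0)"
      by (intro sum.cong) (auto simp: lookup_single when_def split: if_splits)
    also have "\<dots> = (if a + b = m then c * d else 0)"
      by (subst sum.delta) (auto simp: finite_monomial_splittings)
    finally show ?case
      by (simp add: mult_single lookup_single when_def)
  qed (simp_all add: distrib_left lookup_add sum.distrib split_beta)
qed (simp_all add: distrib_right lookup_add sum.distrib split_beta)

lemma quot_finsum: "finite Y \<Longrightarrow> finsum A (\<lambda>i. cl (f i)) Y = cl (sum f Y)"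
proof (induction Y rule: finite_induct)
  interpret cring A
    by (rule quot_cring)
  {
    case empty
    show ?case
      by (simp add: quot_zero)
  next
    case (insert i Y)
    then show ?case
      by (subst finsum_insert) (auto simp: quot_carrier quot_add)
  }
qed

lemma quot_poly_add: "quot_poly F \<oplus>\<^bsub>mpoly_ring A\<^esub> quot_poly G = quot_poly (F + G)"
  by (simp add: mpoly_ring_def quot_poly_def fun_eq_iff quot_add lookup_add)

lemma quot_poly_mult: "quot_poly F \<otimes>\<^bsub>mpoly_ring A\<^esub> quot_poly G = quot_poly (F * G)"
proof
  fix m
  have "(quot_poly F \<otimes>\<^bsub>mpoly_ring A\<^esub> quot_poly G) m =
      finsum A (\<lambda>p. cl (Poly_Mapping.lookup F (fst p) * Poly_Mapping.lookup G (snd p))) {(a, b). a + b = m}"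
    by (simp add: mpoly_ring_def quot_poly_def quot_mult case_prod_unfold)
  also have "\<dots> = cl (\<Sum>p\<in>{(a, b). a + b = m}. Poly_Mapping.lookup F (fst p) * Poly_Mapping.lookup G (snd p))"
    by (rule quot_finsum[OF finite_monomial_splittings])
  also have "\<dots> = quot_poly (F * G) m"
    by (simp add: quot_poly_def lookup_mult_splittings case_prod_unfold)
  finally show "(quot_poly F \<otimes>\<^bsub>mpoly_ring A\<^esub> quot_poly G) m = quot_poly (F * G) m" .
qed

lemma quot_poly_zero: "\<zero>\<^bsub>mpoly_ring A\<^esub> = quot_poly 0"
  and quot_poly_one: "\<one>\<^bsub>mpoly_ring A\<^esub> = quot_poly 1"
  by (simp_all add: mpoly_ring_def quot_poly_def fun_eq_iff quot_zero quot_one lookup_one when_def)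

lemma quot_poly_finite: "{m. quot_poly F m \<noteq> \<zero>\<^bsub>A\<^esub>} \<subseteq> Poly_Mapping.keys F"
  by (auto simp: quot_poly_def quot_zero in_keys_iff)

lemma quot_poly_carrier: "carrier (mpoly_ring A) = range quot_poly"
proof safe
  fix F :: "('n, (nat, 'k) mpoly) mpoly"
  have "finite {m. quot_poly F m \<noteq> \<zero>\<^bsub>A\<^esub>}"
    by (rule finite_subset[OF quot_poly_finite]) simp
  then show "quot_poly F \<in> carrier (mpoly_ring A)"
    by (auto simp: mpoly_ring_def quot_carrier quot_poly_def)
next
  fix f :: "('n \<Rightarrow>\<^sub>0 nat) \<Rightarrow> (nat, 'k) mpoly set"
  assume "f \<in> carrier (mpoly_ring A)"
  then have f: "\<And>m. f m \<in> range cl" and fin: "finite {m. f m \<noteq> cl 0}"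
    by (auto simp: mpoly_ring_def quot_carrier quot_zero)
  from f have "\<forall>m. \<exists>F. f m = cl F"
    by (metis imageE)
  then obtain h where h: "\<And>m. f m = cl (h m)"
    by metis
  \<comment> \<open>Representatives are used only where the class is nonzero, since \<open>h\<close>
    itself need not have finite support.\<close>
  define F where "F = (\<Sum>m\<in>{m. f m \<noteq> cl 0}. Poly_Mapping.single m (h m))"
  have "f m = quot_poly F m" for m
    by (cases "f m = cl 0") (simp_all add: quot_poly_def F_def lookup_sum_single[OF fin] flip: h)
  then have "f = quot_poly F"
    by (rule ext)
  then show "f \<in> range quot_poly"
    by blast
qed

lemma mpoly_ring_cring: "cring (mpoly_ring A :: (('n \<Rightarrow>\<^sub>0 nat) \<Rightarrow> _) ring)"
  by (rule cring_of_surj[of _ quot_poly])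
    (simp_all only: quot_poly_carrier quot_poly_add quot_poly_mult quot_poly_zero quot_poly_one)

text \<open>Coefficients of \<open>F\<close> that become zero in the quotient contribute nothing, as
  \<open>x\<close> maps zero to 0.\<close>

lemma eval_at_quot_poly:
  fixes F :: "('n::finite, (nat, 'k) mpoly) mpoly"
  assumes "x \<in> K_points A"
  shows "eval_at A x p (quot_poly F) = mp_subst (mp_eval (quot_point x)) (($) p) F"
proof -
  have mon: "mon_val (($) p) m = (\<Prod>j\<in>UNIV. (p $ j) ^ Poly_Mapping.lookup m j)" for m
    by (rule mon_val_superset) auto
  have zero: "x \<zero>\<^bsub>A\<^esub> = 0"
    by (simp add: quot_zero K_points_eval[OF assms] rhom_zero[OF rhom_mp_eval])
  have "eval_at A x p (quot_poly F) =
      (\<Sum>m\<in>Poly_Mapping.keys F. x (quot_poly F m) * (\<Prod>j\<in>UNIV. (p $ j) ^ Poly_Mapping.lookup m j))"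
    unfolding eval_at_def by (rule sum.mono_neutral_left) (use quot_poly_finite zero in auto)
  then show ?thesis
    by (simp add: mp_subst_mon_val mon quot_poly_def K_points_eval[OF assms])
qed

text \<open>
  Taking all functions that vanish on the locus cut out by \<open>\<Phi>\<close>, and not the ideal generated
  by \<open>\<Phi>\<close>, reduces the ideal property to \<^const>\<open>eval_at\<close> being a homomorphism.
\<close>

definition subscheme ::
  "('n::finite, (nat, 'k) mpoly) mpoly set \<Rightarrow> (('n \<Rightarrow>\<^sub>0 nat) \<Rightarrow> (nat, 'k) mpoly set) set" where
  "subscheme \<Phi> = {f \<in> carrier (mpoly_ring A). \<forall>x\<in>K_points A. \<forall>p.
     (\<forall>F\<in>\<Phi>. mp_subst (mp_eval (quot_point x)) (($) p) F = 0) \<longrightarrow> eval_at A x p f = 0}"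

text \<open>The class of each \<open>F \<in> \<Phi>\<close> lies in the ideal, so passing to all
  vanishing functions does not change the fibers over rational points.\<close>

lemma fiber_subscheme:
  assumes "x \<in> K_points A"
  shows "fiber A (subscheme \<Phi>) x = {p. \<forall>F\<in>\<Phi>. mp_subst (mp_eval (quot_point x)) (($) p) F = 0}"
proof safe
  fix p F assume p: "p \<in> fiber A (subscheme \<Phi>) x" and "F \<in> \<Phi>"
  then have "quot_poly F \<in> subscheme \<Phi>"
    by (auto simp: subscheme_def quot_poly_carrier eval_at_quot_poly)
  with p have "eval_at A x p (quot_poly F) = 0"
    by (auto simp: fiber_def)
  then show "mp_subst (mp_eval (quot_point x)) (($) p) F = 0"
    by (simp add: eval_at_quot_poly[OF assms])
qed (use assms in \<open>auto simp: fiber_def subscheme_def\<close>)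

lemma closed_subscheme:
  fixes \<Phi> :: "('n::finite, (nat, 'k) mpoly) mpoly set"
  shows "closed_subscheme_prod A (subscheme \<Phi>)"
proof -
  let ?R = "mpoly_ring A :: (('n \<Rightarrow>\<^sub>0 nat) \<Rightarrow> _) ring"
  interpret cring ?R
    by (rule mpoly_ring_cring)
  have mem: "quot_poly F \<in> subscheme \<Phi> \<longleftrightarrow> (\<forall>x\<in>K_points A. \<forall>p.
     (\<forall>F\<in>\<Phi>. mp_subst (mp_eval (quot_point x)) (($) p) F = 0) \<longrightarrow>
       mp_subst (mp_eval (quot_point x)) (($) p) F = 0)" for F
    by (auto simp: subscheme_def quot_poly_carrier eval_at_quot_poly)
  have sub: "subscheme \<Phi> \<subseteq> range quot_poly"
    by (auto simp: subscheme_def quot_poly_carrier)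
  note hom = rhom_simps[OF rhom_mp_subst[OF rhom_mp_eval]]
  have uminus: "\<ominus>\<^bsub>?R\<^esub> quot_poly F = quot_poly (- F)" for F
    by (rule minus_equality) (simp_all add: quot_poly_carrier quot_poly_add quot_poly_zero)
  have "ideal (subscheme \<Phi>) ?R"
  proof (rule idealI)
    show "ring ?R"
      by (rule ring_axioms)
    show "subgroup (subscheme \<Phi>) (add_monoid ?R)"
    proof (rule subgroup.intro)
      show "subscheme \<Phi> \<subseteq> carrier (add_monoid ?R)"
        by (auto simp: subscheme_def)
      show "f \<otimes>\<^bsub>add_monoid ?R\<^esub> g \<in> subscheme \<Phi>" if fg: "f \<in> subscheme \<Phi>" "g \<in> subscheme \<Phi>" for f g
      proof -
        obtain F G where "f = quot_poly F" "g = quot_poly G"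
          using fg sub by blast
        then show ?thesis
          using fg by (simp add: quot_poly_add mem hom)
      qed
      show "\<one>\<^bsub>add_monoid ?R\<^esub> \<in> subscheme \<Phi>"
        by (simp add: quot_poly_zero mem)
      show "inv\<^bsub>add_monoid ?R\<^esub> f \<in> subscheme \<Phi>" if f: "f \<in> subscheme \<Phi>" for f
      proof -
        obtain F where "f = quot_poly F"
          using f sub by blast
        then have "\<ominus>\<^bsub>?R\<^esub> f \<in> subscheme \<Phi>"
          using f by (simp add: uminus mem hom)
        then show ?thesis
          by (simp only: a_inv_def)
      qed
    qed
    fix f g assume f: "f \<in> subscheme \<Phi>" and g: "g \<in> carrier ?R"
    then obtain F G where FG: "f = quot_poly F" "g = quot_poly G"
      using sub by (auto simp: quot_poly_carrier)
    then show "g \<otimes>\<^bsub>?R\<^esub> f \<in> subscheme \<Phi>" "f \<otimes>\<^bsub>?R\<^esub> g \<in> subscheme \<Phi>"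
      using f by (simp_all add: quot_poly_mult mem hom)
  qed
  then show ?thesis
    by (simp add: closed_subscheme_prod_def)
qed

end

section \<open>Sequences over the points of the coordinate ring\<close>

text \<open>Injections between the fibers over each value are glued; \<psi> keeps the images for
  different values disjoint.\<close>

lemma exists_injection_over:
  assumes "finite T" "finite E"
    and card: "\<And>v. v \<in> \<phi> ` T \<Longrightarrow> card {i \<in> T. \<phi> i = v} \<le> card {a \<in> E. \<psi> a = v}"
  shows "\<exists>\<alpha>. inj_on \<alpha> T \<and> \<alpha> ` T \<subseteq> E \<and> (\<forall>i\<in>T. \<psi> (\<alpha> i) = \<phi> i)"
proof -
  have "\<exists>\<beta>. \<beta> ` {i \<in> T. \<phi> i = v} \<subseteq> {a \<in> E. \<psi> a = v} \<and> inj_on \<beta> {i \<in> T. \<phi> i = v}"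
    if "v \<in> \<phi> ` T" for v
    using card[OF that] assms(1,2) by (intro card_le_inj) auto
  then have "\<forall>v. \<exists>\<beta>. v \<in> \<phi> ` T \<longrightarrow>
      \<beta> ` {i \<in> T. \<phi> i = v} \<subseteq> {a \<in> E. \<psi> a = v} \<and> inj_on \<beta> {i \<in> T. \<phi> i = v}"
    by blast
  then obtain \<beta> where "\<forall>v. v \<in> \<phi> ` T \<longrightarrow>
      \<beta> v ` {i \<in> T. \<phi> i = v} \<subseteq> {a \<in> E. \<psi> a = v} \<and> inj_on (\<beta> v) {i \<in> T. \<phi> i = v}"
    by (rule choice[THEN exE])
  then have \<beta>: "\<beta> v ` {i \<in> T. \<phi> i = v} \<subseteq> {a \<in> E. \<psi> a = v}" "inj_on (\<beta> v) {i \<in> T. \<phi> i = v}"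
    if "v \<in> \<phi> ` T" for v
    using that by blast+
  define \<alpha> where "\<alpha> i = \<beta> (\<phi> i) i" for i
  have \<alpha>: "\<alpha> i \<in> E \<and> \<psi> (\<alpha> i) = \<phi> i" if "i \<in> T" for i
    using \<beta>(1)[of "\<phi> i"] that by (auto simp: \<alpha>_def)
  moreover have "inj_on \<alpha> T"
  proof (rule inj_onI)
    fix i i' assume i: "i \<in> T" "i' \<in> T" and eq: "\<alpha> i = \<alpha> i'"
    then have "\<phi> i = \<phi> i'"
      using \<alpha> by metis
    then show "i = i'"
      using inj_onD[OF \<beta>(2)[of "\<phi> i"], of i i'] i eq by (simp add: \<alpha>_def)
  qed
  ultimately show ?thesis
    by blast
qed

lemma polys_bounded_blocks:
  fixes H :: "(nat \<times> 'n::finite, 'k::comm_ring_1) mpoly set"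
  assumes "finite H"
  shows "\<exists>N. \<forall>N'\<ge>N. H \<subseteq> polys ({..<N'} \<times> UNIV)"
  using assms
proof induction
  case (insert f H)
  then obtain N where N: "\<And>N'. N' \<ge> N \<Longrightarrow> H \<subseteq> polys ({..<N'} \<times> UNIV)"
    by blast
  obtain V where V: "finite V" "f \<in> polys V"
    using polys_finite by blast
  then obtain M where M: "fst ` V \<subseteq> {..<M}"
    using finite_nat_bounded[of "fst ` V"] by auto
  have "insert f H \<subseteq> polys ({..<N'} \<times> UNIV)" if "N' \<ge> max N M" for N'
  proof -
    have "V \<subseteq> {..<N'} \<times> UNIV"
      using M that by force
    then show ?thesis
      using N[of N'] that polys_mono[OF _ V(2)] by auto
  qed
  then show ?case
    by blast
qed simp

text \<open>
  The image of an irreducible variety under a rational map is irreducible; the hypothesis on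
  \<open>e\<close> says that its denominators are powers of \<open>c\<close>.
\<close>

lemma rational_image_prime:
  fixes y :: "('v::countable, 'k::alg_closed_field) mpoly set" and e :: "('v \<Rightarrow> 'k) \<Rightarrow> 'w \<Rightarrow> 'k"
  assumes unc: "uncountable (UNIV :: 'k set)" and y: "y \<in> Spec" and c: "c \<notin> y"
    and e: "\<And>i. \<exists>N h. \<forall>q. mp_eval q c \<noteq> 0 \<longrightarrow> mp_eval q h = mp_eval q c ^ N * e q i"
  shows "{F. \<forall>q. (\<forall>f\<in>y. mp_eval q f = 0) \<longrightarrow> mp_eval q c \<noteq> 0 \<longrightarrow> mp_eval (e q) F = 0} \<in> Spec"
    (is "?P \<in> _")
proof -
  \<comment> \<open>Where \<open>c\<close> is nonzero, the pullback of \<open>F\<close> along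
    \<open>e\<close> becomes a polynomial after multiplication by a power of
    \<open>c\<close>.\<close>
  have clear: "\<exists>N h. \<forall>q. mp_eval q c \<noteq> 0 \<longrightarrow> mp_eval q h = mp_eval q c ^ N * mp_eval (e q) F" for F
  proof (induction F rule: mpoly_induct)
    case (const a)
    show ?case
      by (intro exI[of _ 0] exI[of _ "mp_const a"]) simp
  next
    case (var i)
    show ?case
      using e[of i] by simp
  next
    case (add F G)
    then obtain N h M k where "\<forall>q. mp_eval q c \<noteq> 0 \<longrightarrow> mp_eval q h = mp_eval q c ^ N * mp_eval (e q) F"
      "\<forall>q. mp_eval q c \<noteq> 0 \<longrightarrow> mp_eval q k = mp_eval q c ^ M * mp_eval (e q) G"
      by blast
    then show ?case
      by (intro exI[of _ "N + M"] exI[of _ "c ^ M * h + c ^ N * k"]) (simp add: power_add algebra_simps)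
  next
    case (mult F G)
    then obtain N h M k where "\<forall>q. mp_eval q c \<noteq> 0 \<longrightarrow> mp_eval q h = mp_eval q c ^ N * mp_eval (e q) F"
      "\<forall>q. mp_eval q c \<noteq> 0 \<longrightarrow> mp_eval q k = mp_eval q c ^ M * mp_eval (e q) G"
      by blast
    then show ?case
      by (intro exI[of _ "N + M"] exI[of _ "h * k"]) (simp add: power_add algebra_simps)
  qed
  have "F \<in> ?P \<or> G \<in> ?P" if FG: "F * G \<in> ?P" for F G
  proof -
    obtain N h where h: "\<And>q. mp_eval q c \<noteq> 0 \<Longrightarrow> mp_eval q h = mp_eval q c ^ N * mp_eval (e q) F"
      using clear by metis
    obtain M k where k: "\<And>q. mp_eval q c \<noteq> 0 \<Longrightarrow> mp_eval q k = mp_eval q c ^ M * mp_eval (e q) G"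
      using clear by metis
    \<comment> \<open>The factor \<open>c\<close> covers the points where \<open>c\<close> vanishes,
      so that the Nullstellensatz applies to all zeros of \<open>y\<close>.\<close>
    have "mp_eval q (h * k * c) = 0" if "\<forall>f\<in>y. mp_eval q f = 0" for q
      using FG that by (cases "mp_eval q c = 0") (auto simp: h k)
    then have "h * k * c \<in> y"
      using countable_nullstellensatz[OF unc y] by blast
    then have "h \<in> y \<or> k \<in> y"
      using c by (simp add: Spec_prime[OF y])
    then show ?thesis
    proof
      assume "h \<in> y"
      then have "F \<in> ?P"
        using h by fastforce
      then show ?thesis ..
    next
      assume "k \<in> y"
      then have "G \<in> ?P"
        using k by fastforce
      then show ?thesis ..
    qed
  qed
  moreover have "1 \<notin> ?P"
    using countable_nullstellensatz[OF unc y c] by auto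
  ultimately show ?thesis
    unfolding Spec_iff by (auto simp: rhom_zero[OF rhom_mp_eval])
qed

section \<open>Fibrewise values of block polynomials and equations of unions\<close>

definition block_val ::
  "(nat \<times> 'n \<Rightarrow> 'k::comm_ring_1) \<Rightarrow> 'k ^ 'n::finite \<Rightarrow> ('n, 'k) block_poly \<Rightarrow> 'k" where
  "block_val \<nu> p = mp_subst (mp_eval \<nu>) (($) p)"

lemma block_val_cong:
  assumes "\<And>m. Poly_Mapping.lookup G m \<in> polys V" "\<And>v. v \<in> V \<Longrightarrow> \<nu> v = \<mu> v"
  shows "block_val \<nu> p G = block_val \<mu> p G"
  using mp_eval_cong_polys[OF assms(1,2)] by (simp add: block_val_def mp_subst_mon_val)

lemma mp_eval_at_block: "mp_eval \<nu> (at_block w G) = block_val \<nu> (\<chi> j. \<nu> (w, j)) G"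
proof -
  have "($) (\<chi> j. \<nu> (w, j)) = (\<lambda>j. \<nu> (w, j))"
    by (rule ext) simp
  then show ?thesis
    by (simp add: at_block_def block_val_def mp_subst_comp[OF rhom_mp_eval rhom_id])
qed

text \<open>The shift by \<open>Suc\<close> keeps variable 0 free for the inverse of the element to
  be localized at.\<close>

definition to_quot :: "('v::countable, 'k::comm_ring_1) mpoly \<Rightarrow> (nat, 'k) mpoly" where
  "to_quot = mp_subst mp_const (\<lambda>v. mp_var (Suc (to_nat v)))"

lemma rhom_to_quot: "rhom to_quot"
  unfolding to_quot_def by (rule rhom_mp_subst[OF rhom_mp_const])

lemma to_quot_var [simp]: "to_quot (mp_var v) = mp_var (Suc (to_nat v))"
  by (simp add: to_quot_def mp_subst_var' rhom_mp_const)

lemma mp_eval_to_quot: "mp_eval \<zeta> (to_quot f) = mp_eval (\<lambda>v. \<zeta> (Suc (to_nat v))) f"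
  unfolding to_quot_def mp_subst_comp[OF rhom_mp_eval rhom_mp_const] mp_eval_simps by (simp add: mp_eval_def id_def)

text \<open>
  Equations for the union of the common zeros of the polynomials \<open>G\<close> with the points
  \<open>(x\<^sub>a\<^sub>j)\<^sub>j\<close>, \<open>a \<in> T\<close>: the factor for \<open>a\<close> is a coordinate \<open>s a\<close> chosen freely.
\<close>

definition union_eqs ::
  "('n::finite, 'k::comm_ring_1) block_poly set \<Rightarrow> nat set \<Rightarrow> ('n, (nat, 'k) mpoly) mpoly set" where
  "union_eqs \<G> T = {mp_subst (\<lambda>h. mp_const (to_quot h)) mp_var G *
     (\<Prod>a\<in>T. mp_var (s a) - mp_const (mp_var (Suc (to_nat (a, s a))))) | G s. G \<in> \<G>}"

text \<open>If \<open>p\<close> differs from all the points, choose for each \<open>a\<close> a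
  coordinate \<open>s a\<close> where it differs; the product over \<open>T\<close> is then nonzero
  and the factor from \<open>G\<close> must vanish.\<close>

lemma union_eqs_vanish_iff:
  fixes p :: "'k::field ^ 'n::finite"
  assumes "finite T"
  shows "(\<forall>F\<in>union_eqs \<G> T. mp_subst (mp_eval \<zeta>) (($) p) F = 0) \<longleftrightarrow>
    (\<forall>G\<in>\<G>. block_val (\<lambda>v. \<zeta> (Suc (to_nat v))) p G = 0) \<or> (\<exists>a\<in>T. \<forall>j. p $ j = \<zeta> (Suc (to_nat (a, j))))"
    (is "?L \<longleftrightarrow> ?R")
proof -
  let ?\<epsilon> = "mp_subst (mp_eval \<zeta>) (($) p)"
  have \<epsilon>: "rhom ?\<epsilon>"
    by (rule rhom_mp_subst[OF rhom_mp_eval])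
  have G: "?\<epsilon> (mp_subst (\<lambda>h. mp_const (to_quot h)) mp_var G) = block_val (\<lambda>v. \<zeta> (Suc (to_nat v))) p G" for G
    by (simp add: mp_subst_comp[OF \<epsilon> rhom_comp[OF rhom_mp_const rhom_to_quot]] block_val_def
        mp_subst_const' mp_subst_var' rhom_mp_eval mp_eval_to_quot)
  have F: "?\<epsilon> (mp_subst (\<lambda>h. mp_const (to_quot h)) mp_var G *
      (\<Prod>a\<in>T. mp_var (s a) - mp_const (mp_var (Suc (to_nat (a, s a)))))) =
    block_val (\<lambda>v. \<zeta> (Suc (to_nat v))) p G * (\<Prod>a\<in>T. p $ s a - \<zeta> (Suc (to_nat (a, s a))))" for G s
    by (simp add: rhom_simps[OF \<epsilon>] rhom_prod[OF \<epsilon>] G mp_subst_const' mp_subst_var' rhom_mp_eval)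
  show ?thesis
  proof
    assume L: ?L
    show ?R
    proof (rule ccontr)
      assume "\<not> ?R"
      then obtain G where G: "G \<in> \<G>" "block_val (\<lambda>v. \<zeta> (Suc (to_nat v))) p G \<noteq> 0"
        and "\<forall>a\<in>T. \<exists>j. p $ j \<noteq> \<zeta> (Suc (to_nat (a, j)))"
        by blast
      then obtain s where s: "\<forall>a\<in>T. p $ s a \<noteq> \<zeta> (Suc (to_nat (a, s a)))"
        by metis
      have "block_val (\<lambda>v. \<zeta> (Suc (to_nat v))) p G * (\<Prod>a\<in>T. p $ s a - \<zeta> (Suc (to_nat (a, s a)))) = 0"
        unfolding F[symmetric] by (rule bspec[OF L]) (use G(1) in \<open>auto simp: union_eqs_def\<close>)
      then show False
        using G(2) s assms by auto
    qed
  next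
    assume ?R
    then show ?L
      using assms by (auto simp: union_eqs_def F)
  qed
qed


theorem theorem3p22:
  fixes y I :: "(nat \<times> 'n::finite, 'k::alg_closed_field) mpoly set"
  assumes "uncountable (UNIV :: 'k set)"
    and "y \<in> Spec"
    and "I = vanishing_ideal (orbit_closure y)"
  shows "\<exists>(A :: 'k coord_ring) (r :: nat) (\<Sigma> :: nat \<Rightarrow> (('n \<Rightarrow>\<^sub>0 nat) \<Rightarrow> (nat, 'k) mpoly set) set)
           (m :: nat \<Rightarrow> nat).
           affine_integral_finite_type A \<and>
           (\<forall>j\<in>{0..r}. closed_subscheme_prod A (\<Sigma> j)) \<and>
           I = vanishing_ideal_seqs
                 {p :: nat \<Rightarrow> 'k ^ 'n. \<exists>x\<in>K_points A.
                    (\<forall>i. p i \<in> fiber A (\<Sigma> 0) x) \<and>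
                    (\<forall>j\<in>{1..r}. finite {i. p i \<notin> fiber A (\<Sigma> j) x} \<and>
                                 card {i. p i \<notin> fiber A (\<Sigma> j) x} \<le> m j)}"
proof -
  note unc = assms(1) and y = assms(2)
  have I: "I = {f. \<forall>\<sigma>\<in>Sym_infty. perm_act \<sigma> f \<in> y}"
    unfolding assms(3) by (rule vanishing_ideal_orbit_closure[OF y])
  obtain r :: "('n \<Rightarrow>\<^sub>0 nat) \<Rightarrow> nat" where r: "inj r" "\<And>a b c. r a < r b \<Longrightarrow> r (a + c) < r (b + c)"
    using exists_monomial_rank by blast
  obtain B and g :: "('n \<Rightarrow>\<^sub>0 nat) \<Rightarrow> ('n, 'k) block_poly" where B: "finite B"
    and g_fin: "\<And>b. b \<in> B \<Longrightarrow> finite {w. at_block w (g b) \<notin> y}"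
    and g_unit: "\<And>b. b \<in> B \<Longrightarrow> Poly_Mapping.lookup (g b) b \<notin> y"
    and g_lead: "\<And>b m. b \<in> B \<Longrightarrow> m \<in> Poly_Mapping.keys (g b) \<Longrightarrow> m \<noteq> b \<Longrightarrow> r m < r b"
    and indep: "\<And>f. finite {w. at_block w f \<notin> y} \<Longrightarrow> \<exists>m. Poly_Mapping.lookup f m \<notin> y \<Longrightarrow>
         \<exists>b\<in>B. \<exists>d. Poly_Mapping.lookup f (b + d) \<notin> y"
    using exists_block_basis[OF y r(1)] by (elim exE conjE) blast

  \<comment> \<open>the exceptional blocks, and when two of them carry the same point\<close>
  define E where "E = (\<Union>b\<in>B. {w. at_block w (g b) \<notin> y})"
  have E: "finite E"
    using B g_fin by (simp add: E_def)
  have vanish: "at_block w (g b) \<in> y" if "b \<in> B" "w \<notin> E" for b w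
    using that by (auto simp: E_def)
  define D :: "nat \<Rightarrow> nat \<Rightarrow> 'n \<Rightarrow> (nat \<times> 'n, 'k) mpoly"
    where "D a a' j = mp_var (a, j) - mp_var (a', j)" for a a' j
  define eqv where "eqv a a' \<longleftrightarrow> (\<forall>j. D a a' j \<in> y)" for a a'
  have "\<forall>a a'. \<exists>j. \<not> eqv a a' \<longrightarrow> D a a' j \<notin> y"
    by (auto simp: eqv_def)
  then obtain sep where sep: "\<And>a a'. \<not> eqv a a' \<Longrightarrow> D a a' (sep a a') \<notin> y"
    by metis
  define pairs where "pairs = {(a, a'). a \<in> E \<and> a' \<in> E \<and> \<not> eqv a a'}"
  have pairs: "finite pairs"
    by (rule finite_subset[of _ "E \<times> E"]) (auto simp: pairs_def E)
  \<comment> \<open>\<open>c\<close> gathers what must stay nonzero on the parameter space: the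
    leading coefficients, and a separating coordinate difference for each pair of distinct
    exceptional points.\<close>
  define c where "c = (\<Prod>b\<in>B. Poly_Mapping.lookup (g b) b) * (\<Prod>(a, a')\<in>pairs. D a a' (sep a a'))"
  have c: "c \<notin> y"
    unfolding c_def Spec_prime[OF y] Spec_prod[OF y B] Spec_prod[OF y pairs]
    using g_unit sep by (auto simp: pairs_def)

  define H where "H = (\<Union>b\<in>B. Poly_Mapping.lookup (g b) ` Poly_Mapping.keys (g b))"
  have "finite H"
    using B by (simp add: H_def)
  then obtain N1 where N1: "\<And>N'. N' \<ge> N1 \<Longrightarrow> H \<subseteq> polys ({..<N'} \<times> UNIV)"
    using polys_bounded_blocks by blast
  obtain N2 where N2: "E \<subseteq> {..<N2}"
    using finite_nat_bounded[OF E] by blast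
  \<comment> \<open>The first \<open>N0\<close> blocks contain the exceptional ones and all
    variables in the coefficients of the basis.\<close>
  define N0 where "N0 = max N1 N2"
  define V0 where "V0 = {..<N0} \<times> (UNIV :: 'n set)"
  have E0: "a < N0" if "a \<in> E" for a
    using N2 that by (auto simp: N0_def)
  have coeffs: "Poly_Mapping.lookup (g b) m \<in> polys V0" if "b \<in> B" for b m
  proof (cases "m \<in> Poly_Mapping.keys (g b)")
    case True
    then show ?thesis
      using N1[of N0] that by (auto simp: H_def V0_def N0_def)
  qed (simp add: in_keys_iff)
  have D0: "D a a' j \<in> polys V0" if "a \<in> E" "a' \<in> E" for a a' j
    using E0 that by (auto simp: D_def V0_def intro!: polys_diff polys.var)
  have c0: "c \<in> polys V0"
    unfolding c_def by (intro polys.mult polys_prod) (auto simp: pairs_def coeffs D0)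

  \<comment> \<open>\<open>z\<^sub>0\<close> is the inverse of \<open>c\<close>, the other coordinates are those of the first \<open>N0\<close> blocks\<close>
  define code :: "nat \<times> 'n \<Rightarrow> nat" where "code v = Suc (to_nat v)" for v
  define e :: "(nat \<times> 'n \<Rightarrow> 'k) \<Rightarrow> nat \<Rightarrow> 'k" where "e q i = (if i = 0 then inverse (mp_eval q c)
    else if i \<in> code ` V0 then q (from_nat (i - 1)) else 0)" for q i
  have e_code: "e q (code v) = q v" if "v \<in> V0" for q v
    using that by (auto simp: e_def code_def)
  \<comment> \<open>\<open>P\<close> is the vanishing ideal of the image under \<open>e\<close> of
    those zeros of \<open>y\<close> where \<open>c\<close> is nonzero.\<close>
  define P where "P = {F. \<forall>q. (\<forall>f\<in>y. mp_eval q f = 0) \<longrightarrow> mp_eval q c \<noteq> 0 \<longrightarrow> mp_eval (e q) F = 0}"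
  have P: "P \<in> Spec"
    unfolding P_def
  proof (rule rational_image_prime[OF unc y c])
    fix i
    show "\<exists>N h. \<forall>q. mp_eval q c \<noteq> 0 \<longrightarrow> mp_eval q h = mp_eval q c ^ N * e q i"
    proof (cases "i = 0")
      case True
      then show ?thesis
        by (intro exI[of _ 1] exI[of _ 1]) (simp add: e_def)
    next
      case False
      then show ?thesis
        by (intro exI[of _ 0] exI[of _ "if i \<in> code ` V0 then mp_var (from_nat (i - 1)) else 0"])
          (simp add: e_def rhom_zero[OF rhom_mp_eval])
    qed
  qed
  define A where "A = quot_algebra P"
  have "finite (insert 0 (code ` V0))"
    by (simp add: V0_def)
  then have A: "affine_integral_finite_type A"
    unfolding A_def by (rule quot_affine_integral_finite_type[OF P]) (auto simp: P_def e_def)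
  define \<nu> where "\<nu> x v = quot_point P x (code v)" for x v
  have \<nu>_eval: "mp_eval (quot_point P x) (to_quot f) = mp_eval (\<nu> x) f" for x f
    unfolding mp_eval_to_quot \<nu>_def code_def ..
  have e_eval: "mp_eval (e q) (to_quot f) = mp_eval q f" if "f \<in> polys V0" for q f
    unfolding mp_eval_to_quot using e_code that
    by (intro mp_eval_cong_polys[OF that]) (simp add: code_def)
  have \<nu>_vanish: "mp_eval (\<nu> x) f = 0" if "x \<in> K_points A" "f \<in> y" "f \<in> polys V0" for x f
  proof -
    have "to_quot f \<in> P"
      using that(2,3) by (simp add: P_def e_eval)
    then show ?thesis
      using K_points_vanish[OF P] that(1) by (simp add: A_def flip: \<nu>_eval)
  qed
  \<comment> \<open>The relation saying that variable 0 is inverse to \<open>c\<close> belongs to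
    \<open>P\<close>.\<close>
  have \<nu>_c: "mp_eval (\<nu> x) c \<noteq> 0" if "x \<in> K_points A" for x
  proof -
    have "mp_var 0 * to_quot c - 1 \<in> P"
      by (simp add: P_def e_eval[OF c0]) (simp add: e_def)
    then have "mp_eval (quot_point P x) (mp_var 0 * to_quot c - 1) = 0"
      using that unfolding A_def by (intro K_points_vanish[OF P])
    then show ?thesis
      by (auto simp: \<nu>_eval)
  qed
  have \<nu>_unit: "mp_eval (\<nu> x) (Poly_Mapping.lookup (g b) b) \<noteq> 0" if "x \<in> K_points A" "b \<in> B" for x b
    using \<nu>_c[OF that(1)] that(2) B by (auto simp: c_def rhom_prod[OF rhom_mp_eval])
  \<comment> \<open>Equalities of exceptional points persist as relations in \<open>y\<close>;
    inequalities persist because \<open>c\<close> is nonzero.\<close>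
  have \<nu>_eqv: "(\<forall>j. \<nu> x (a, j) = \<nu> x (a', j)) \<longleftrightarrow> eqv a a'"
    if x: "x \<in> K_points A" and a: "a \<in> E" "a' \<in> E" for x a a'
  proof
    assume eq: "\<forall>j. \<nu> x (a, j) = \<nu> x (a', j)"
    show "eqv a a'"
    proof (rule ccontr)
      assume "\<not> eqv a a'"
      then have "(a, a') \<in> pairs"
        using a by (simp add: pairs_def)
      moreover have "mp_eval (\<nu> x) (D a a' (sep a a')) = 0"
        using eq by (simp add: D_def)
      ultimately have "mp_eval (\<nu> x) c = 0"
        using pairs by (auto simp: c_def rhom_prod[OF rhom_mp_eval])
      then show False
        using \<nu>_c[OF x] by simp
    qed
  next
    assume "eqv a a'"
    then have "mp_eval (\<nu> x) (D a a' j) = 0" for j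
      using \<nu>_vanish[OF x _ D0[OF a]] by (simp add: eqv_def)
    then show "\<forall>j. \<nu> x (a, j) = \<nu> x (a', j)"
      by (simp add: D_def)
  qed

  define R where "R = card E"
  \<comment> \<open>\<open>h\<close> numbers the exceptional blocks from 1. Blocks carrying the same
    point repeat the same condition, and \<open>m j\<close> counts them.\<close>
  obtain h where h: "bij_betw h {1..R} E"
    unfolding R_def using ex_bij_betw_nat_finite_1[OF E] by blast
  define T where "T j = (if j = 0 then E else {a \<in> E. \<not> eqv a (h j)})" for j
  define m where "m j = card {a \<in> E. eqv a (h j)}" for j
  define \<Sigma> where "\<Sigma> j = subscheme P (union_eqs (g ` B) (T j))" for j
  have fiber: "p \<in> fiber A (\<Sigma> j) x \<longleftrightarrow> (\<forall>b\<in>B. block_val (\<nu> x) p (g b) = 0) \<or>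
      (\<exists>a\<in>T j. \<forall>i. p $ i = \<nu> x (a, i))" if "x \<in> K_points A" for x j and p :: "'k ^ 'n"
  proof -
    have "finite (T j)"
      using E by (simp add: T_def)
    then show ?thesis
      using that unfolding \<Sigma>_def A_def \<nu>_def code_def
      by (simp add: fiber_subscheme[OF P] union_eqs_vanish_iff)
  qed
  define Q :: "(nat \<Rightarrow> 'k ^ 'n) set" where "Q = {p. \<exists>x\<in>K_points A. (\<forall>i. p i \<in> fiber A (\<Sigma> 0) x) \<and>
    (\<forall>j\<in>{1..R}. finite {i. p i \<notin> fiber A (\<Sigma> j) x} \<and> card {i. p i \<notin> fiber A (\<Sigma> j) x} \<le> m j)}"

  have "mp_eval (\<lambda>(i, j). p i $ j) f = 0" if f: "f \<in> I" and p: "p \<in> Q" for f and p :: "nat \<Rightarrow> 'k ^ 'n"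
  proof -
    obtain x where x: "x \<in> K_points A" and p0: "\<And>i. p i \<in> fiber A (\<Sigma> 0) x"
      and pj: "\<And>j. j \<in> {1..R} \<Longrightarrow> finite {i. p i \<notin> fiber A (\<Sigma> j) x}"
        "\<And>j. j \<in> {1..R} \<Longrightarrow> card {i. p i \<notin> fiber A (\<Sigma> j) x} \<le> m j"
      using p unfolding Q_def by blast
    obtain k where k: "f \<in> polys ({..<k} \<times> UNIV)"
      using polys_bounded_blocks[of "{f}"] by auto
    \<comment> \<open>Points with index in \<open>S\<close> are off the common zeros of the basis
      over \<open>x\<close>, hence exceptional; the bounds \<open>m j\<close> allow placing them
      injectively on exceptional blocks.\<close>
    define S where "S = {i. i < k \<and> \<not> (\<forall>b\<in>B. block_val (\<nu> x) (p i) (g b) = 0)}"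
    define pt :: "nat \<Rightarrow> 'k ^ 'n" where "pt a = (\<chi> j. \<nu> x (a, j))" for a
    have pt: "v = pt a \<longleftrightarrow> (\<forall>j. v $ j = \<nu> x (a, j))" for v :: "'k ^ 'n" and a
      by (auto simp: pt_def vec_eq_iff)
    have "\<exists>\<alpha>. inj_on \<alpha> S \<and> \<alpha> ` S \<subseteq> E \<and> (\<forall>i\<in>S. pt (\<alpha> i) = p i)"
    proof (rule exists_injection_over)
      show "finite S"
        by (simp add: S_def)
      show "finite E"
        by (rule E)
      fix v assume "v \<in> p ` S"
      then obtain i where i: "i \<in> S" "v = p i"
        by blast
      then obtain a where a: "a \<in> E" "p i = pt a"
        using p0[of i] unfolding fiber[OF x] S_def T_def pt by auto
      then obtain j where j: "j \<in> {1..R}" "h j = a"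
        using h by (metis bij_betw_iff_bijections)
      have pt_eqv: "pt a' = pt a \<longleftrightarrow> eqv a' a" if "a' \<in> E" for a'
        using \<nu>_eqv[OF x that a(1)] by (simp add: pt_def vec_eq_iff)
      \<comment> \<open>No block in \<open>T j\<close> carries the point \<open>v\<close>, so each
        such index violates condition \<open>j\<close>.\<close>
      have "{i \<in> S. p i = v} \<subseteq> {i. p i \<notin> fiber A (\<Sigma> j) x}"
      proof safe
        fix i' assume i': "i' \<in> S" "v = p i'" and "p i' \<in> fiber A (\<Sigma> j) x"
        then obtain a' where "a' \<in> T j" "p i' = pt a'"
          unfolding fiber[OF x] S_def pt by auto
        then show False
          using j pt_eqv i a i' by (auto simp: T_def)
      qed
      then have "card {i \<in> S. p i = v} \<le> m j"
        using card_mono pj[OF j(1)] by (meson le_trans)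
      also have "m j = card {a' \<in> E. pt a' = v}"
        unfolding m_def using pt_eqv i a j by (intro arg_cong[of _ _ card]) auto
      finally show "card {i \<in> S. p i = v} \<le> card {a' \<in> E. pt a' = v}" .
    qed
    then obtain \<alpha> where \<alpha>: "inj_on \<alpha> S" "\<And>i. i \<in> S \<Longrightarrow> \<alpha> i \<in> E" "\<And>i. i \<in> S \<Longrightarrow> pt (\<alpha> i) = p i"
      by blast
    \<comment> \<open>move the exceptional indices to exceptional blocks and the others to fresh ones\<close>
    define \<tau> where "\<tau> i = (if i \<in> S then \<alpha> i else N0 + i)" for i
    define W where "W = (\<lambda>i. N0 + i) ` ({..<k} - S)"
    \<comment> \<open>\<mu> keeps \<open>\<nu> x\<close> on the first \<open>N0\<close> blocks and
      puts \<open>p i\<close> on block \<open>N0 + i\<close>, so block \<open>\<tau> i\<close>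
      carries \<open>p i\<close> for all \<open>i < k\<close>.\<close>
    define \<mu> where "\<mu> = (\<lambda>(i, j). if i < N0 then \<nu> x (i, j) else p (i - N0) $ j)"
    have \<mu>0: "\<mu> v = \<nu> x v" if "v \<in> V0" for v
      using that by (auto simp: \<mu>_def V0_def)
    have \<mu>_eval: "mp_eval \<mu> f = mp_eval (\<nu> x) f" if "f \<in> polys V0" for f
      by (rule mp_eval_cong_polys[OF that \<mu>0])
    have "mp_eval \<mu> (perm_act \<tau> f) = 0"
    proof (rule specialization[where E = E and ?V0.0 = V0 and ?N0.0 = N0 and r = r and g = g and B = B
          and W = W])
      show "mp_eval \<mu> (Poly_Mapping.lookup (g b) b) \<noteq> 0" if "b \<in> B" for b
        using \<nu>_unit[OF x that] \<mu>_eval[OF coeffs[OF that]] by simp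
      show "mp_eval \<mu> f = 0" if "f \<in> y" "f \<in> polys V0" for f
        using \<nu>_vanish[OF x that] \<mu>_eval[OF that(2)] by simp
      show "finite W" "W \<inter> {..<N0} = {}"
        by (auto simp: W_def)
      show "mp_eval \<mu> (at_block w (g b)) = 0" if w: "w \<in> W" and b: "b \<in> B" for w b
      proof -
        obtain i where i: "i < k" "i \<notin> S" "w = N0 + i"
          using w by (auto simp: W_def)
        have "(\<chi> j. \<mu> (w, j)) = p i"
          by (simp add: \<mu>_def i vec_eq_iff)
        then have "mp_eval \<mu> (at_block w (g b)) = block_val \<mu> (p i) (g b)"
          by (simp add: mp_eval_at_block)
        also have "\<dots> = block_val (\<nu> x) (p i) (g b)"
          by (rule block_val_cong[OF coeffs[OF b] \<mu>0])
        also have "\<dots> = 0"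
          using i b by (auto simp: S_def)
        finally show ?thesis .
      qed
      have "\<tau> ` {..<k} \<subseteq> {..<N0} \<union> W"
        using E0 \<alpha>(2) by (auto simp: \<tau>_def W_def)
      then show "perm_act \<tau> f \<in> polys (({..<N0} \<union> W) \<times> UNIV)"
        by (intro polys_mono[OF _ polys_perm_act[OF k]]) auto
      fix \<rho> :: "nat \<Rightarrow> nat" assume \<rho>: "\<And>i. i < N0 \<Longrightarrow> \<rho> i = i" "inj_on \<rho> W" "\<rho> ` W \<inter> E = {}"
      have \<rho>\<tau>: "\<rho> (\<tau> i) = \<alpha> i" "\<rho> (\<tau> i) \<in> E" if "i \<in> S" for i
        using that \<rho>(1) E0 \<alpha>(2) by (auto simp: \<tau>_def)
      have \<rho>\<tau>': "\<rho> (\<tau> i) \<notin> E" if "i < k" "i \<notin> S" for i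
        using that \<rho>(3) by (auto simp: \<tau>_def W_def)
      \<comment> \<open>\<rho> fixes the exceptional blocks and maps \<open>W\<close> injectively
        outside \<open>E\<close>, so the two kinds of indices cannot collide.\<close>
      have "inj_on (\<rho> \<circ> \<tau>) {..<k}"
      proof (rule inj_onI)
        fix i i' assume i: "i \<in> {..<k}" "i' \<in> {..<k}" and eq: "(\<rho> \<circ> \<tau>) i = (\<rho> \<circ> \<tau>) i'"
        consider "i \<in> S" "i' \<in> S" | "i \<notin> S" "i' \<notin> S"
          using \<rho>\<tau>(2) \<rho>\<tau>' i eq by (metis comp_apply lessThan_iff)
        then show "i = i'"
        proof cases
          case 1
          then show ?thesis
            using inj_onD[OF \<alpha>(1)] eq \<rho>\<tau>(1) by simp
        next
          case 2
          with i have W: "N0 + i \<in> W" "N0 + i' \<in> W"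
            by (simp_all add: W_def)
          have "\<rho> (N0 + i) = \<rho> (N0 + i')"
            using 2 eq by (simp add: \<tau>_def)
          then have "N0 + i = N0 + i'"
            using W by (rule inj_onD[OF \<rho>(2)])
          then show ?thesis
            by simp
        qed
      qed
      then show "perm_act \<rho> (perm_act \<tau> f) \<in> y"
        unfolding perm_act_comp using f k by (intro perm_act_mem_of_inj[OF _ k]) (auto simp: I)
    qed (fact y E V0_def r(2) coeffs g_lead vanish indep)+
    also have "mp_eval \<mu> (perm_act \<tau> f) = mp_eval (\<lambda>(i, j). p i $ j) f"
      unfolding mp_eval_perm_act
    proof (rule mp_eval_cong_polys[OF k])
      fix v assume "v \<in> {..<k} \<times> (UNIV :: 'n set)"
      moreover have "\<mu> (\<tau> i, j) = p i $ j" for i j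
      proof (cases "i \<in> S")
        case True
        then show ?thesis
          using \<alpha>(2,3)[OF True] E0 by (auto simp: \<tau>_def \<mu>_def pt_def vec_eq_iff)
      qed (simp add: \<tau>_def \<mu>_def)
      ultimately show "(\<lambda>(i, j). \<mu> (\<tau> i, j)) v = (\<lambda>(i, j). p i $ j) v"
        by (simp add: split_beta)
    qed
    finally show ?thesis .
  qed
  moreover have "\<exists>p\<in>Q. mp_eval (\<lambda>(i, j). (p i :: 'k ^ 'n) $ j) f \<noteq> 0" if f: "f \<notin> I" for f
  proof -
    obtain \<sigma> where \<sigma>: "\<sigma> \<in> Sym_infty" "perm_act \<sigma> f \<notin> y"
      using f by (auto simp: I)
    \<comment> \<open>The factor \<open>c\<close> ensures that \<open>e q\<close> is a point of the
      parameter space.\<close>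
    then have "c * perm_act \<sigma> f \<notin> y"
      using c by (simp add: Spec_prime[OF y])
    then obtain q where q: "\<And>f. f \<in> y \<Longrightarrow> mp_eval q f = 0" "mp_eval q (c * perm_act \<sigma> f) \<noteq> 0"
      using countable_nullstellensatz[OF unc y] by blast
    have "mp_eval (e q) F = 0" if "F \<in> P" for F
      using that q by (auto simp: P_def)
    then obtain x where x: "x \<in> K_points A" and qx: "quot_point P x = e q"
      unfolding A_def using exists_K_point[OF P] by blast
    have \<nu>q: "\<nu> x v = q v" if "v \<in> V0" for v
      by (simp add: \<nu>_def qx e_code[OF that])
    \<comment> \<open>With the blocks of \<open>q\<close> rearranged by \<sigma>, evaluating
      \<open>f\<close> at \<open>p\<close> is evaluating \<open>perm_act \<sigma> f\<close> at
      \<open>q\<close>.\<close>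
    define p :: "nat \<Rightarrow> 'k ^ 'n" where "p i = (\<chi> j. q (\<sigma> i, j))" for i
    have ordinary: "block_val (\<nu> x) (p i) (g b) = 0" if "\<sigma> i \<notin> E" "b \<in> B" for i b
    proof -
      have "block_val (\<nu> x) (p i) (g b) = block_val q (p i) (g b)"
        by (rule block_val_cong[OF coeffs[OF that(2)] \<nu>q])
      also have "\<dots> = mp_eval q (at_block (\<sigma> i) (g b))"
        by (simp add: mp_eval_at_block p_def)
      finally show ?thesis
        using q(1) vanish[OF that(2,1)] by simp
    qed
    have exceptional: "p i $ j = \<nu> x (\<sigma> i, j)" if "\<sigma> i \<in> E" for i j
      using E0[OF that] by (simp add: p_def \<nu>q V0_def)
    have "p i \<in> fiber A (\<Sigma> 0) x" for i
      unfolding fiber[OF x] using ordinary exceptional by (cases "\<sigma> i \<in> E") (auto simp: T_def)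
    moreover have "finite {i. p i \<notin> fiber A (\<Sigma> j) x} \<and> card {i. p i \<notin> fiber A (\<Sigma> j) x} \<le> m j"
      if j: "j \<in> {1..R}" for j
    proof -
      let ?Y = "{i. p i \<notin> fiber A (\<Sigma> j) x}"
      \<comment> \<open>A violating index is sent to one of the \<open>m j\<close> blocks carrying
        the omitted point, and \<sigma> is injective.\<close>
      have "\<sigma> i \<in> E \<and> eqv (\<sigma> i) (h j)" if "i \<in> ?Y" for i
      proof -
        have no: "\<not> (\<forall>b\<in>B. block_val (\<nu> x) (p i) (g b) = 0)" "\<not> (\<exists>a\<in>T j. \<forall>l. p i $ l = \<nu> x (a, l))"
          using that unfolding mem_Collect_eq fiber[OF x] by blast+
        then have "\<sigma> i \<in> E"
          using ordinary by blast
        moreover have "\<sigma> i \<notin> T j"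
          using no(2) exceptional[OF \<open>\<sigma> i \<in> E\<close>] by blast
        ultimately show ?thesis
          using j by (auto simp: T_def)
      qed
      then have sub: "\<sigma> ` ?Y \<subseteq> {a \<in> E. eqv a (h j)}"
        by blast
      have inj: "inj_on \<sigma> ?Y"
        using Sym_infty_inv(4)[OF \<sigma>(1)] by (rule inj_on_subset) simp
      have fin: "finite {a \<in> E. eqv a (h j)}"
        using E by simp
      show ?thesis
        unfolding m_def using inj_on_finite[OF inj sub fin] card_inj_on_le[OF inj sub fin] by blast
    qed
    ultimately have "p \<in> Q"
      unfolding Q_def using x by blast
    moreover have "(\<lambda>(i, j). p i $ j) = (\<lambda>(i, j). q (\<sigma> i, j))"
      by (auto simp: p_def fun_eq_iff)
    then have "mp_eval (\<lambda>(i, j). p i $ j) f = mp_eval q (perm_act \<sigma> f)"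
      by (simp only: mp_eval_perm_act)
    then have "mp_eval (\<lambda>(i, j). p i $ j) f \<noteq> 0"
      using q(2) by simp
    ultimately show ?thesis
      by blast
  qed
  ultimately have "I = vanishing_ideal_seqs Q"
    unfolding vanishing_ideal_seqs_def mp_eval_def by blast
  moreover have "closed_subscheme_prod A (\<Sigma> j)" for j
    unfolding A_def \<Sigma>_def by (rule closed_subscheme[OF P])
  ultimately show ?thesis
    unfolding Q_def using A
    by (intro exI[of _ A] exI[of _ R] exI[of _ \<Sigma>] exI[of _ m]) simp
qed

end
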